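(* Let $a\in(0,1]$ and $s\in(0,2]$. For $s\in(0,2)$ define $$I_a(s,d)=\frac{2^{s/2}}{\Gamma(1-s/2)}\sum_{n=0}^d\binom dn\frac1{2^d}\sum_{k=0}^\infty w_{k,n}\,\mathrm B\Big(k+1-\frac s2,\frac d2+\frac s2\Big),$$ $$w_{k,n}=\frac12(1-a^2)^k\Big[\binom{\frac{d-n}2+k-1}{k}n+a^2(d-n)\binom{\frac{d-n}2+k}{k}\Big],$$ and set $I_a(2,d)=(1+a^2)\frac d2$. Then for every $k\ge0$, $$\mathbb E\big[\|x^{(k)}\|^s\big]=\|x^{(0)}\|^s\big(\sigma^sI_a(s,d)\big)^k.$$ Let $\bar\sigma_a(s,d)=I_a(s,d)^{-1/s}$ and assume $x^{(0)}\neq0$. Then: (i) if $\sigma=\bar\sigma_a(s,d)$, then $\mathbb E\|x^{(k)}\|^s=\|x^{(0)}\|^s$ for all $k\ge1$, while $\mathbb E\|x^{(k)}\|^p\to\infty$ exponentially fast in $k$ for every $p>s$; (ii) if $\sigma<\bar\sigma_a(s,d)$, then $\mathbb E\|x^{(k)}\|^s\to0$ exponentially fast; (iii) if $\sigma>\bar\sigma_a(s,d)$, then $\mathbb E\|x^{(k)}\|^s\to\infty$ exponentially fast.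
   Context: Fix an integer width $d\ge1$ and a parameter $a\in[0,1]$. The parametric ReLU $\phi_a:\mathbb{R}\to\mathbb{R}$ is $\phi_a(z)=z$ for $z>0$ and $\phi_a(z)=az$ for $z\le 0$; it is applied componentwise to vectors ($\phi_0$ is ReLU, $\phi_1$ is the identity). Given $\sigma>0$ and a deterministic input $x^{(0)}\in\mathbb{R}^d$, the layer outputs of the fully connected network with zero biases are $x^{(k+1)}=\phi_a(W^{(k+1)}x^{(k)})$, $k\ge0$, where all entries of all matrices $W^{(1)},W^{(2)},\dots\in\mathbb{R}^{d\times d}$ are i.i.d. $\mathcal{N}(0,\sigma^2)$. $\|\cdot\|$ denotes the Euclidean norm. For real $r$ and integer $k\ge0$, $\binom rk=r(r-1)\cdots(r-k+1)/k!$ (equal to $1$ for $k=0$). $\mathrm B(x,y)=\int_0^1t^{x-1}(1-t)^{y-1}dt$ is the Beta function. *)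

theory Defs
  imports "HOL-Analysis.Analysis" "HOL-Probability.Probability"
begin

definition prelu :: "real \<Rightarrow> real \<Rightarrow> real" where
  "prelu a z = (if z > 0 then z else a * z)"

text \<open>Layer outputs. The random weights are a single sample
  w :: nat \<times> 'd \<times> 'd \<Rightarrow> real, where w (k, i, j) is the entry (i,j)
  of the matrix W^(k+1).\<close>
fun layer :: "real \<Rightarrow> real ^ 'd \<Rightarrow> (nat \<times> 'd \<times> 'd \<Rightarrow> real) \<Rightarrow> nat \<Rightarrow> real ^ 'd" where
  "layer a x0 w 0 = x0"
| "layer a x0 w (Suc k) =
     (\<chi> i. prelu a (\<Sum>j\<in>UNIV. w (k, i, j) * (layer a x0 w k $ j)))"

definition weight_space :: "real \<Rightarrow> (nat \<times> 'd \<times> 'd \<Rightarrow> real) measure" where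
  "weight_space \<sigma> = PiM UNIV (\<lambda>_. density lborel (normal_density 0 \<sigma>))"

definition moment :: "real \<Rightarrow> real \<Rightarrow> real ^ 'd \<Rightarrow> real \<Rightarrow> nat \<Rightarrow> ennreal" where
  "moment a \<sigma> x0 p k =
     (\<integral>\<^sup>+ w. ennreal (norm (layer a x0 w k) powr p) \<partial>(weight_space \<sigma>))"

definition w_coef :: "real \<Rightarrow> nat \<Rightarrow> nat \<Rightarrow> nat \<Rightarrow> real" where
  "w_coef a d k n = 1/2 * (1 - a\<^sup>2) ^ k *
     ((((real (d - n)) / 2 + real k - 1) gchoose k) * real n
      + a\<^sup>2 * real (d - n) * (((real (d - n)) / 2 + real k) gchoose k))"

definition I_a :: "real \<Rightarrow> real \<Rightarrow> nat \<Rightarrow> real" where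
  "I_a a s d =
     (if s = 2 then (1 + a\<^sup>2) * real d / 2
      else 2 powr (s/2) / Gamma (1 - s/2) *
        (\<Sum>n=0..d. real (d choose n) / 2 ^ d *
           (\<Sum>k. w_coef a d k n * Beta (real k + 1 - s/2) (real d/2 + s/2))))"

definition sigma_bar :: "real \<Rightarrow> real \<Rightarrow> nat \<Rightarrow> real" where
  "sigma_bar a s d = I_a a s d powr (-1/s)"

end

theory Submission
  imports Defs
begin

text \<open>
  For a fixed vector \<open>x\<close> the coordinates of \<open>W x\<close> are independent centred Gaussians of standard deviation
  \<open>\<sigma> |x|\<close>, and \<open>prelu\<close> is positively homogeneous. Since each layer is independent of the previous ones, every layer
  multiplies the \<open>p\<close>-th moment by \<open>\<sigma>\<^sup>p E[S\<^bsup>p/2\<^esup>]\<close>, where \<open>S\<close> is the sum of \<open>prelu a (Z\<^sub>i)\<^sup>2\<close> over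
  independent standard normal \<open>Z\<^sub>i\<close>.

  For \<open>q = s/2 < 1\<close> one writes \<open>\<Gamma>(1-q) S\<^sup>q\<close> as the integral of \<open>t\<^bsup>-q\<^esup> S e\<^bsup>-tS\<^esup>\<close> over \<open>t > 0\<close>.
  The expectation of \<open>S e\<^bsup>-tS\<^esup>\<close> factorises over the coordinates; expanding it by the binomial theorem
  and then into binomial series in \<open>2t/(1+2t)\<close> leaves Beta integrals, all terms being nonnegative.
  This gives \<open>I_a\<close>.

  At the critical variance \<open>U = \<sigma>\<^sup>s S\<^bsup>s/2\<^esup>\<close> has mean 1 but is not almost surely constant, so the tangent
  inequality \<open>U\<^bsup>p/s\<^esup> \<ge> 1 + (p/s)(U - 1)\<close>, strict for \<open>U \<noteq> 1\<close>, makes the factor of every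
  higher moment exceed 1.
\<close>

section \<open>Gamma and Beta integrals\<close>

text \<open>Substitute \<open>t = c * u\<close> in Euler's integral. Nonnegative integrals are used
  throughout, so that later exchanges of integrals and sums need no integrability proof.\<close>

lemma nn_integral_Gamma_scaled:
  fixes x c :: real
  assumes "x > 0" "c > 0"
  shows "(\<integral>\<^sup>+u. ennreal (indicator {0..} u * u powr (x - 1) * exp (- (c * u))) \<partial>lborel)
           = ennreal (Gamma x * c powr (- x))"
proof -
  let ?f = "\<lambda>t::real. ennreal (indicator {0..} t * t powr (x - 1) / exp t)"
  let ?g = "\<lambda>u::real. ennreal (indicator {0..} u * u powr (x - 1) * exp (- (c * u)))"
  have "ennreal (Gamma x) = ennreal \<bar>c\<bar> * (\<integral>\<^sup>+u. ?f (0 + c * u) \<partial>lborel)"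
    using Gamma_conv_nn_integral_real[OF assms(1)] nn_integral_real_affine[of ?f c 0] assms by simp
  also have "(\<integral>\<^sup>+u. ?f (0 + c * u) \<partial>lborel) = (\<integral>\<^sup>+u. ennreal (c powr (x - 1)) * ?g u \<partial>lborel)"
    using assms
    by (intro nn_integral_cong)
       (auto simp: indicator_def powr_mult exp_minus field_simps zero_le_mult_iff simp flip: ennreal_mult'')
  also have "\<dots> = ennreal (c powr (x - 1)) * (\<integral>\<^sup>+u. ?g u \<partial>lborel)"
    by (rule nn_integral_cmult) simp
  finally have "ennreal (Gamma x) = ennreal (c powr x) * (\<integral>\<^sup>+u. ?g u \<partial>lborel)"
    using assms by (simp add: mult.assoc[symmetric] powr_diff flip: ennreal_mult'')
  then have "ennreal (c powr (-x)) * ennreal (Gamma x) =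
      ennreal (c powr (-x)) * ennreal (c powr x) * (\<integral>\<^sup>+u. ?g u \<partial>lborel)"
    by (simp add: mult.assoc)
  also have "ennreal (c powr (-x)) * ennreal (c powr x) = 1"
    using assms by (simp add: powr_minus flip: ennreal_mult'')
  finally show ?thesis by (simp add: mult.commute flip: ennreal_mult'')
qed

text \<open>Times \<open>Gamma (x + y)\<close>, the factor \<open>(1 + u) powr (- (x + y))\<close>
  is a Gamma integral in a new variable \<open>r\<close> with rate \<open>1 + u\<close>. After
  exchanging the integrals, the one over \<open>u\<close> gives
  \<open>Gamma x * r powr (- x)\<close>, and the remaining one over \<open>r\<close> gives
  \<open>Gamma y\<close>.\<close>

lemma nn_integral_Beta_second_kind:
  fixes x y :: real
  assumes "x > 0" "y > 0"
  shows "(\<integral>\<^sup>+u. ennreal (indicator {0..} u * u powr (x - 1) * (1 + u) powr (- (x + y))) \<partial>lborel)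
           = ennreal (Beta x y)" (is "?L = _")
proof -
  let ?K = "\<lambda>u r::real. ennreal (indicator {0..} u * u powr (x - 1)) *
               ennreal (indicator {0..} r * r powr (x + y - 1) * exp (- ((1 + u) * r)))"
  have "ennreal (Gamma (x + y)) * ?L =
      (\<integral>\<^sup>+u. ennreal (Gamma (x + y)) *
         ennreal (indicator {0..} u * u powr (x - 1) * (1 + u) powr (- (x + y))) \<partial>lborel)"
    by (rule nn_integral_cmult[symmetric]) simp
  also have "\<dots> = (\<integral>\<^sup>+u. (\<integral>\<^sup>+r. ?K u r \<partial>lborel) \<partial>lborel)"
  proof (intro nn_integral_cong)
    fix u :: real
    show "ennreal (Gamma (x + y)) * ennreal (indicator {0..} u * u powr (x - 1) * (1 + u) powr (- (x + y)))
        = (\<integral>\<^sup>+r. ?K u r \<partial>lborel)"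
    proof (cases "u \<ge> 0")
      case True
      then show ?thesis
        using assms nn_integral_Gamma_scaled[of "x + y" "1 + u"]
        by (subst nn_integral_cmult) (auto simp: mult_ac simp flip: ennreal_mult'')
    qed (simp add: indicator_def)
  qed
  also have "\<dots> = (\<integral>\<^sup>+r. (\<integral>\<^sup>+u. ?K u r \<partial>lborel) \<partial>lborel)"
    by (rule lborel_pair.Fubini') measurable
  also have "\<dots> = (\<integral>\<^sup>+r. ennreal (Gamma x) * ennreal (indicator {0..} r * r powr (y - 1) / exp r) \<partial>lborel)"
  proof (intro nn_integral_cong)
    fix r :: real
    show "(\<integral>\<^sup>+u. ?K u r \<partial>lborel) = ennreal (Gamma x) * ennreal (indicator {0..} r * r powr (y - 1) / exp r)"
    proof (cases "r > 0")
      case True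
      have "(\<integral>\<^sup>+u. ?K u r \<partial>lborel) = (\<integral>\<^sup>+u. ennreal (r powr (x + y - 1) * exp (- r)) *
          ennreal (indicator {0..} u * u powr (x - 1) * exp (- (r * u))) \<partial>lborel)"
        using True by (intro nn_integral_cong)
          (auto simp: indicator_def algebra_simps exp_diff exp_minus exp_add divide_inverse simp flip: ennreal_mult'')
      also have "\<dots> = ennreal (r powr (x + y - 1) * exp (- r)) * ennreal (Gamma x * r powr (- x))"
        using nn_integral_Gamma_scaled[of x r] assms True by (subst nn_integral_cmult) auto
      also have "\<dots> = ennreal (Gamma x) * ennreal (indicator {0..} r * r powr (y - 1) / exp r)"
        using True assms
        by (auto simp: exp_minus powr_minus powr_diff powr_add field_simps simp flip: ennreal_mult'')
      finally show ?thesis .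
    qed (auto simp: indicator_def)
  qed
  also have "\<dots> = ennreal (Gamma x) * ennreal (Gamma y)"
    using Gamma_conv_nn_integral_real[OF assms(2)] by (subst nn_integral_cmult) auto
  finally have eq: "ennreal (Gamma (x + y)) * ?L = ennreal (Gamma x * Gamma y)"
    using assms by (simp add: ennreal_mult'')
  have "ennreal (1 / Gamma (x + y)) * ennreal (Gamma (x + y)) = 1"
    using assms Gamma_real_pos[of "x + y"] by (simp del: Gamma_real_pos flip: ennreal_mult'')
  then have "?L = ennreal (1 / Gamma (x + y)) * (ennreal (Gamma (x + y)) * ?L)"
    by (simp add: mult.assoc[symmetric])
  also have "\<dots> = ennreal (Beta x y)"
    unfolding eq using assms by (simp add: Beta_def flip: ennreal_mult'')
  finally show ?thesis .
qed

text \<open>This is the integral left over for each term of the series, with \<open>b = d/2\<close>.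
  Put \<open>u = 2 * t\<close>: the factor \<open>2 powr q\<close> comes from
  \<open>t powr (- q)\<close> and the factor 1/2 from \<open>dt\<close>. The Beta arguments add up
  to \<open>k + b + 1\<close>, the total power of \<open>1 + 2 * t\<close> in the
  denominator.\<close>

lemma nn_integral_Beta_kernel:
  fixes q b :: real and k :: nat
  assumes "0 < q" "q < 1" "b > 0"
  shows "(\<integral>\<^sup>+t. ennreal (indicator {0..} t * t powr (- q) * (2 * t / (1 + 2 * t)) ^ k * (1 + 2 * t) powr (- b - 1)) \<partial>lborel)
           = ennreal (2 powr q / 2 * Beta (real k + 1 - q) (b + q))"
proof -
  define x where "x = real k + 1 - q"
  define y where "y = b + q"
  have xy: "x > 0" "y > 0" using assms by (auto simp: x_def y_def)
  let ?f = "\<lambda>u::real. ennreal (indicator {0..} u * u powr (x - 1) * (1 + u) powr (- (x + y)))"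
  have "(\<integral>\<^sup>+t. ennreal (indicator {0..} t * t powr (- q) * (2 * t / (1 + 2 * t)) ^ k * (1 + 2 * t) powr (- b - 1)) \<partial>lborel)
      = (\<integral>\<^sup>+t. ennreal (2 powr q) * ?f (0 + 2 * t) \<partial>lborel)"
  proof (intro nn_integral_cong)
    fix t :: real
    show "ennreal (indicator {0..} t * t powr (- q) * (2 * t / (1 + 2 * t)) ^ k * (1 + 2 * t) powr (- b - 1))
        = ennreal (2 powr q) * ?f (0 + 2 * t)"
    proof (cases "t > 0")
      case True
      have 1: "(2 * t / (1 + 2 * t)) ^ k = (2 * t) powr real k * (1 + 2 * t) powr (- real k)"
        using True by (simp add: powr_realpow powr_minus power_divide field_simps)
      have 2: "t powr (- q) = 2 powr q * (2 * t) powr (- q)"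
        using True by (simp add: powr_mult powr_minus)
      have 3: "(2 * t) powr (- q) * (2 * t) powr real k = (2 * t) powr (x - 1)"
        by (simp add: x_def flip: powr_add)
      have 4: "(1 + 2 * t) powr (- real k) * (1 + 2 * t) powr (- b - 1) = (1 + 2 * t) powr (- (x + y))"
        by (simp add: x_def y_def diff_diff_eq add_ac flip: powr_add)
      have "t powr (- q) * (2 * t / (1 + 2 * t)) ^ k * (1 + 2 * t) powr (- b - 1)
          = 2 powr q * ((2 * t) powr (- q) * (2 * t) powr real k) *
             ((1 + 2 * t) powr (- real k) * (1 + 2 * t) powr (- b - 1))"
        unfolding 1 2 by (simp add: mult_ac)
      then have "t powr (- q) * (2 * t / (1 + 2 * t)) ^ k * (1 + 2 * t) powr (- b - 1)
          = 2 powr q * ((2 * t) powr (x - 1) * (1 + 2 * t) powr (- (x + y)))"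
        unfolding 3 4 by (simp add: mult_ac)
      then show ?thesis using True by (simp add: indicator_def flip: ennreal_mult'')
    qed (auto simp: indicator_def)
  qed
  also have "\<dots> = ennreal (2 powr q) * (\<integral>\<^sup>+t. ?f (0 + 2 * t) \<partial>lborel)"
    by (rule nn_integral_cmult) simp
  also have "\<dots> = ennreal (2 powr q / 2) * (ennreal \<bar>2\<bar> * (\<integral>\<^sup>+t. ?f (0 + 2 * t) \<partial>lborel))"
    by (simp add: mult.assoc[symmetric] flip: ennreal_mult'' del: ennreal_numeral)
  also have "ennreal \<bar>2\<bar> * (\<integral>\<^sup>+t. ?f (0 + 2 * t) \<partial>lborel) = (\<integral>\<^sup>+t. ?f t \<partial>lborel)"
    by (rule nn_integral_real_affine[symmetric]) auto
  also have "\<dots> = ennreal (Beta x y)"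
    by (rule nn_integral_Beta_second_kind[OF xy])
  finally show ?thesis using xy by (simp add: x_def y_def Beta_def flip: ennreal_mult'')
qed

section \<open>Binomial expansions\<close>

text \<open>Both generalized binomials have the form \<open>(x + k - 1) gchoose k\<close> with
  \<open>x \<ge> 0\<close>, which is a rising factorial over k!. For \<open>n = d\<close> the first
  has \<open>x = 0\<close> and vanishes for \<open>k > 0\<close>. The sign is what permits
  integrating the series term by term.\<close>

lemma w_coef_nonneg:
  assumes "0 < a" "a \<le> 1"
  shows "0 \<le> w_coef a d k n"
proof -
  have gchoose_nonneg: "0 \<le> (x + real k - 1) gchoose k" if "x \<ge> 0" for x :: real
    using that pochhammer_nonneg[of x k]
    by (cases "x = 0") (auto simp: gbinomial_pochhammer' pochhammer_0_left)
  have "0 \<le> 1 - a\<^sup>2" using assms by (simp add: abs_square_le_1)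
  then show ?thesis
    using assms gchoose_nonneg[of "real (d - n) / 2"] gchoose_nonneg[of "real (d - n) / 2 + 1"]
    by (simp add: w_coef_def)
qed

text \<open>Newton's series for \<open>(1 - z) powr (- b)\<close>: negating the upper index produces
  a sign that cancels the one in \<open>(- z) ^ k\<close>.\<close>

lemma negative_binomial_series:
  fixes z b :: real
  assumes "\<bar>z\<bar> < 1"
  shows "(\<lambda>k. ((b + real k - 1) gchoose k) * z ^ k) sums (1 - z) powr (- b)"
proof -
  have "((- b) gchoose k) * (- z) ^ k = ((b + real k - 1) gchoose k) * z ^ k" for k
    unfolding gbinomial_minus power_minus[of z] by (simp add: mult_ac)
  then show ?thesis using gen_binomial_real[of "- z" "- b"] assms by simp
qed

text \<open>Here \<open>r = 1 - z\<close> with \<open>z = (1 - a\<^sup>2) * v\<close> and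
  \<open>v = 2t/(1+2t) < 1\<close>, so the series converges for every \<open>t \<ge> 0\<close>. The
  two binomials in \<open>w_coef\<close> are the coefficients of the negative binomial series with
  exponents \<open>(d - n)/2\<close> and \<open>(d - n)/2 + 1\<close>.\<close>

lemma w_coef_sums:
  fixes a t :: real
  assumes "0 < a" "a \<le> 1" "t \<ge> 0"
  defines "r \<equiv> (1 + 2 * a\<^sup>2 * t) / (1 + 2 * t)"
  shows "(\<lambda>k. w_coef a d k n * (2 * t / (1 + 2 * t)) ^ k) sums
     (1/2 * (real n * r powr (- (real (d - n) / 2)) + a\<^sup>2 * real (d - n) * r powr (- (real (d - n) / 2) - 1)))"
proof -
  define m where "m = real (d - n) / 2"
  define v where "v = 2 * t / (1 + 2 * t)"
  define z where "z = (1 - a\<^sup>2) * v"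
  have v: "0 \<le> v" "v < 1" using assms by (auto simp: v_def)
  have a2: "0 < a\<^sup>2" "a\<^sup>2 \<le> 1" using assms by (auto simp: abs_square_le_1)
  have "z \<le> v" using v a2 by (simp add: z_def mult_left_le_one_le)
  moreover have "z \<ge> 0" using v a2 by (simp add: z_def)
  ultimately have z: "\<bar>z\<bar> < 1" using v by simp
  have r: "r = 1 - z" using assms(3) by (simp add: r_def z_def v_def field_simps)
  have "(\<lambda>k. 1/2 * (real n * (((m + real k - 1) gchoose k) * z ^ k)
      + a\<^sup>2 * real (d - n) * ((((m + 1) + real k - 1) gchoose k) * z ^ k))) sums
     (1/2 * (real n * (1 - z) powr (- m) + a\<^sup>2 * real (d - n) * (1 - z) powr (- (m + 1))))"
    by (intro sums_mult sums_add negative_binomial_series z)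
  moreover have "w_coef a d k n * v ^ k = 1/2 * (real n * (((m + real k - 1) gchoose k) * z ^ k)
      + a\<^sup>2 * real (d - n) * ((((m + 1) + real k - 1) gchoose k) * z ^ k))" for k
    unfolding z_def power_mult_distrib by (simp add: w_coef_def m_def algebra_simps)
  ultimately have "(\<lambda>k. w_coef a d k n * v ^ k) sums
     (1/2 * (real n * (1 - z) powr (- m) + a\<^sup>2 * real (d - n) * (1 - z) powr (- (m + 1))))"
    by presburger
  then show ?thesis by (simp add: r m_def v_def)
qed

text \<open>The absorption identity \<open>n * (d choose n) = d * ((d - 1) choose (n - 1))\<close>
  reduces the sum weighted by \<open>n\<close> to the binomial theorem in degree
  \<open>d - 1\<close>. The sum weighted by \<open>d - n\<close> is its mirror image under
  \<open>n \<mapsto> d - n\<close>. The extra squares complete the single factors to cubes.\<close>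

lemma binomial_size_bias:
  fixes \<alpha> \<beta> c :: real
  shows "(\<Sum>n\<le>d. real (d choose n) * (real n * \<alpha> ^ (n + 2) * \<beta> ^ (d - n) + c * real (d - n) * \<alpha> ^ n * \<beta> ^ (d - n + 2)))
       = real d * (\<alpha> ^ 3 + c * \<beta> ^ 3) * (\<alpha> + \<beta>) ^ (d - 1)"
proof (cases d)
  case (Suc e)
  have A: "(\<Sum>n\<le>d. real (d choose n) * (real n * \<alpha> ^ n * \<beta> ^ (d - n))) = real d * \<alpha> * (\<alpha> + \<beta>) ^ e" for \<alpha> \<beta> :: real
  proof -
    have "(\<Sum>n\<le>Suc e. real (Suc e choose n) * (real n * \<alpha> ^ n * \<beta> ^ (Suc e - n)))
        = (\<Sum>n\<le>e. real (Suc e choose Suc n) * (real (Suc n) * \<alpha> ^ Suc n * \<beta> ^ (e - n)))"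
      by (subst sum.atMost_Suc_shift) simp
    also have "\<dots> = (\<Sum>n\<le>e. real (Suc e) * \<alpha> * (real (e choose n) * \<alpha> ^ n * \<beta> ^ (e - n)))"
    proof (intro sum.cong refl)
      fix n
      have "real (Suc e choose Suc n) * real (Suc n) = real (Suc e) * real (e choose n)"
        using Suc_times_binomial[of n e] by (metis of_nat_mult mult.commute)
      then show "real (Suc e choose Suc n) * (real (Suc n) * \<alpha> ^ Suc n * \<beta> ^ (e - n)) =
          real (Suc e) * \<alpha> * (real (e choose n) * \<alpha> ^ n * \<beta> ^ (e - n))"
        by (simp only: power_Suc mult.assoc[symmetric]) (simp only: mult_ac)
    qed
    also have "\<dots> = real (Suc e) * \<alpha> * (\<alpha> + \<beta>) ^ e"
      by (simp add: binomial_ring sum_distrib_left)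
    finally show ?thesis by (simp add: Suc)
  qed
  have B: "(\<Sum>n\<le>d. real (d choose n) * (real (d - n) * \<alpha> ^ n * \<beta> ^ (d - n))) = real d * \<beta> * (\<alpha> + \<beta>) ^ e"
  proof -
    have "(\<Sum>n\<le>d. real (d choose n) * (real (d - n) * \<alpha> ^ n * \<beta> ^ (d - n)))
        = (\<Sum>n\<le>d. real (d choose n) * (real n * \<beta> ^ n * \<alpha> ^ (d - n)))"
      by (rule sum.reindex_bij_witness[of _ "\<lambda>n. d - n" "\<lambda>n. d - n"])
         (auto simp: binomial_symmetric[symmetric] mult_ac)
    then show ?thesis using A[of \<beta> \<alpha>] by (simp add: add.commute)
  qed
  have "(\<Sum>n\<le>d. real (d choose n) * (real n * \<alpha> ^ (n + 2) * \<beta> ^ (d - n) + c * real (d - n) * \<alpha> ^ n * \<beta> ^ (d - n + 2)))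
      = \<alpha>\<^sup>2 * (\<Sum>n\<le>d. real (d choose n) * (real n * \<alpha> ^ n * \<beta> ^ (d - n)))
        + c * \<beta>\<^sup>2 * (\<Sum>n\<le>d. real (d choose n) * (real (d - n) * \<alpha> ^ n * \<beta> ^ (d - n)))"
    unfolding sum_distrib_left sum.distrib[symmetric]
    by (intro sum.cong refl) (simp add: power_add power2_eq_square algebra_simps)
  then show ?thesis
    unfolding A B by (simp add: Suc algebra_simps power2_eq_square power3_eq_cube)
qed simp

section \<open>Gaussian integrals of the parametric ReLU\<close>

abbreviation std_normal :: "real measure" where
  "std_normal \<equiv> density lborel (normal_density 0 1)"

text \<open>Rescale the known half-line moment by \<open>sqrt c\<close>: the monomial contributes
  \<open>c ^ k\<close> and the differential \<open>sqrt c\<close>, hence the exponent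
  \<open>- k - 1/2\<close>.\<close>

lemma nn_integral_half_Gaussian:
  fixes c :: real
  assumes "c > 0"
  shows "(\<integral>\<^sup>+x. ennreal (indicator {0..} x * (exp (- (c * x\<^sup>2)) * x ^ (2 * k))) \<partial>lborel)
    = ennreal (sqrt pi / 2 * (fact (2 * k) / (2 ^ (2 * k) * fact k)) * c powr (- real k - 1/2))"
proof -
  let ?f = "\<lambda>x::real. ennreal (indicator {0..} x * (exp (- x\<^sup>2) * x ^ (2 * k)))"
  let ?g = "\<lambda>x::real. ennreal (indicator {0..} x * (exp (- (c * x\<^sup>2)) * x ^ (2 * k)))"
  let ?I = "sqrt pi / 2 * (fact (2 * k) / (2 ^ (2 * k) * fact k))"
  have "has_bochner_integral lborel (\<lambda>x::real. indicator {0..} x * (exp (-x\<^sup>2)*x^(2 * k))) ?I"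
    using gaussian_moment_even_pos[of k] by simp
  then have "ennreal ?I = (\<integral>\<^sup>+x. ?f x \<partial>lborel)"
    by (subst nn_integral_eq_integral) (auto simp: has_bochner_integral_iff)
  also have "\<dots> = ennreal \<bar>sqrt c\<bar> * (\<integral>\<^sup>+x. ?f (0 + sqrt c * x) \<partial>lborel)"
    using assms by (intro nn_integral_real_affine) auto
  also have "(\<integral>\<^sup>+x. ?f (0 + sqrt c * x) \<partial>lborel) = (\<integral>\<^sup>+x. ennreal (c ^ k) * ?g x \<partial>lborel)"
    using assms power_mult[of "sqrt c" 2 k]
    by (intro nn_integral_cong)
       (auto simp: indicator_def power_mult_distrib zero_le_mult_iff mult_ac simp flip: ennreal_mult'')
  also have "\<dots> = ennreal (c ^ k) * (\<integral>\<^sup>+x. ?g x \<partial>lborel)"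
    by (rule nn_integral_cmult) simp
  finally have eq: "ennreal ?I = ennreal (sqrt c * c ^ k) * (\<integral>\<^sup>+x. ?g x \<partial>lborel)"
    using assms by (simp add: mult.assoc ennreal_mult)
  have inv: "c powr (- real k - 1/2) * (sqrt c * c ^ k) = 1"
    using assms by (simp add: powr_diff powr_minus powr_realpow powr_half_sqrt)
  have "ennreal (c powr (- real k - 1/2)) * ennreal ?I =
      ennreal (c powr (- real k - 1/2) * (sqrt c * c ^ k)) * (\<integral>\<^sup>+x. ?g x \<partial>lborel)"
    using assms unfolding eq by (subst ennreal_mult) (auto simp: mult.assoc)
  also have "\<dots> = (\<integral>\<^sup>+x. ?g x \<partial>lborel)"
    unfolding inv by simp
  finally have "(\<integral>\<^sup>+x. ?g x \<partial>lborel) = ennreal (c powr (- real k - 1/2)) * ennreal ?I" ..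
  also have "\<dots> = ennreal (?I * c powr (- real k - 1/2))"
    by (subst ennreal_mult[symmetric]) (auto simp: mult.commute)
  finally show ?thesis .
qed

text \<open>In general the value carries the double factorial \<open>(2k-1)!!\<close>, which equals
  1 exactly for \<open>k \<le> 1\<close>. Only the mass and the second moment are required
  below.\<close>

lemma nn_integral_half_normal:
  fixes b :: real
  assumes "b \<ge> 0" "k \<le> 1"
  shows "(\<integral>\<^sup>+z. ennreal (indicator {0..} z * (z ^ (2 * k) * exp (- (b * z\<^sup>2)))) \<partial>std_normal)
    = ennreal ((1 + 2 * b) powr (- real k - 1/2) / 2)"
proof -
  \<comment> \<open>The 1/2 is the rate of the standard normal density itself.\<close>
  define c where "c = b + 1/2"
  have c: "c > 0" "1 + 2 * b = 2 * c" using assms by (auto simp: c_def)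
  have "(\<integral>\<^sup>+z. ennreal (indicator {0..} z * (z ^ (2 * k) * exp (- (b * z\<^sup>2)))) \<partial>std_normal)
      = (\<integral>\<^sup>+z. ennreal (1 / sqrt (2 * pi)) *
          ennreal (indicator {0..} z * (exp (- (c * z\<^sup>2)) * z ^ (2 * k))) \<partial>lborel)"
    by (subst nn_integral_density)
       (auto intro!: nn_integral_cong simp: normal_density_def c_def indicator_def algebra_simps
          simp flip: ennreal_mult'' exp_add)
  also have "\<dots> = ennreal (1 / sqrt (2 * pi) * (sqrt pi / 2 * (fact (2 * k) / (2 ^ (2 * k) * fact k)) * c powr (- real k - 1/2)))"
    by (subst nn_integral_cmult) (auto simp: nn_integral_half_Gaussian[OF c(1)] simp flip: ennreal_mult'')
  also have "1 / sqrt (2 * pi) * (sqrt pi / 2 * (fact (2 * k) / (2 ^ (2 * k) * fact k)) * c powr (- real k - 1/2))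
      = (1 + 2 * b) powr (- real k - 1/2) / 2"
  proof -
    have "k = 0 \<or> k = 1" using assms by auto
    moreover have "sqrt (2 * pi) = sqrt 2 * sqrt pi" by (rule real_sqrt_mult)
    moreover have "(2::real) powr (-1/2) = 1 / sqrt 2" by (simp add: powr_minus powr_half_sqrt field_simps)
    moreover have "(2::real) powr (-3/2) = 1 / (2 * sqrt 2)"
      using powr_add[of "2::real" "-1" "-1/2"] \<open>(2::real) powr (-1/2) = 1 / sqrt 2\<close> by (simp add: powr_minus)
    ultimately show ?thesis using c
      by (auto simp: powr_mult fact_numeral numeral_2_eq_2)
  qed
  finally show ?thesis .
qed

lemma nn_integral_std_normal_minus:
  assumes [measurable]: "f \<in> borel_measurable borel"
  shows "(\<integral>\<^sup>+z. f (- z) \<partial>std_normal) = (\<integral>\<^sup>+z. f z \<partial>std_normal)"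
proof -
  have "(\<integral>\<^sup>+z. f z \<partial>std_normal) = (\<integral>\<^sup>+z. ennreal (normal_density 0 1 z) * f z \<partial>lborel)"
    by (subst nn_integral_density) auto
  also have "\<dots> = ennreal \<bar>-1\<bar> * (\<integral>\<^sup>+z. ennreal (normal_density 0 1 (0 + (-1) * z)) * f (0 + (-1) * z) \<partial>lborel)"
    by (rule nn_integral_real_affine) auto
  also have "\<dots> = (\<integral>\<^sup>+z. f (- z) \<partial>std_normal)"
    by (subst nn_integral_density) (auto simp: normal_density_def)
  finally show ?thesis ..
qed

lemma prelu_measurable [measurable]: "prelu a \<in> borel_measurable borel"
  unfolding prelu_def[abs_def] by measurable

text \<open>Cut the line at 0 and reflect the negative half by the symmetry of the Gaussian; there
  the activation takes the value \<open>- (a * z)\<close>.\<close>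

lemma nn_integral_prelu:
  assumes [measurable]: "g \<in> borel_measurable borel"
  shows "(\<integral>\<^sup>+z. g (prelu a z) \<partial>std_normal) =
    (\<integral>\<^sup>+z. indicator {0..} z * g z \<partial>std_normal) + (\<integral>\<^sup>+z. indicator {0..} z * g (- (a * z)) \<partial>std_normal)"
proof -
  \<comment> \<open>Both closed half-lines contain 0, so the pointwise splitting is valid only off
    this null set.\<close>
  have "AE z in lborel. z \<noteq> (0::real)"
    by (rule AE_lborel_singleton)
  then have "AE z in std_normal. z \<noteq> 0"
    by (subst AE_density) (auto elim: eventually_mono)
  then have "(\<integral>\<^sup>+z. g (prelu a z) \<partial>std_normal) =
      (\<integral>\<^sup>+z. indicator {0..} z * g z + indicator {0..} (- z) * g (- (a * (- z))) \<partial>std_normal)"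
    by (intro nn_integral_cong_AE) (auto elim!: eventually_mono simp: prelu_def indicator_def)
  also have "\<dots> = (\<integral>\<^sup>+z. indicator {0..} z * g z \<partial>std_normal) +
      (\<integral>\<^sup>+z. indicator {0..} (- z) * g (- (a * (- z))) \<partial>std_normal)"
    by (rule nn_integral_add) auto
  also have "(\<integral>\<^sup>+z. indicator {0..} (- z) * g (- (a * (- z))) \<partial>std_normal)
      = (\<integral>\<^sup>+z. indicator {0..} z * g (- (a * z)) \<partial>std_normal)"
    by (rule nn_integral_std_normal_minus[of "\<lambda>z. indicator {0..} z * g (- (a * z))"]) auto
  finally show ?thesis .
qed

text \<open>For \<open>k = 0\<close> this is the Laplace transform of one squared activation, for
  \<open>k = 1\<close> its size-weighted version. Even powers lose the sign on the negative half,
  which therefore contributes the factor \<open>a ^ (2 * k)\<close> and the rate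
  \<open>t * a\<^sup>2\<close>.\<close>

lemma nn_integral_prelu_Laplace:
  fixes a t :: real
  assumes "t \<ge> 0" "k \<le> 1"
  shows "(\<integral>\<^sup>+z. ennreal (prelu a z ^ (2 * k) * exp (- (t * (prelu a z)\<^sup>2))) \<partial>std_normal)
    = ennreal (((1 + 2 * t) powr (- real k - 1/2) + a ^ (2 * k) * (1 + 2 * a\<^sup>2 * t) powr (- real k - 1/2)) / 2)"
proof -
  have "(\<integral>\<^sup>+z. ennreal (prelu a z ^ (2 * k) * exp (- (t * (prelu a z)\<^sup>2))) \<partial>std_normal) =
     (\<integral>\<^sup>+z. ennreal (indicator {0..} z * (z ^ (2 * k) * exp (- (t * z\<^sup>2)))) \<partial>std_normal) +
     (\<integral>\<^sup>+z. ennreal (a ^ (2 * k)) * ennreal (indicator {0..} z * (z ^ (2 * k) * exp (- (t * a\<^sup>2 * z\<^sup>2)))) \<partial>std_normal)"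
    by (subst nn_integral_prelu)
       (auto intro!: arg_cong2[of _ _ _ _ "(+)"] nn_integral_cong
          simp: indicator_def power_mult_distrib mult_ac simp flip: ennreal_mult'')
  also have "\<dots> = ennreal ((1 + 2 * t) powr (- real k - 1/2) / 2) +
      ennreal (a ^ (2 * k)) * ennreal ((1 + 2 * (t * a\<^sup>2)) powr (- real k - 1/2) / 2)"
    using assms by (subst nn_integral_cmult) (simp_all add: nn_integral_half_normal)
  also have "\<dots> = ennreal ((1 + 2 * t) powr (- real k - 1/2) / 2 +
      a ^ (2 * k) * ((1 + 2 * (t * a\<^sup>2)) powr (- real k - 1/2) / 2))"
    by (subst ennreal_plus) (auto simp flip: ennreal_mult'')
  finally show ?thesis
    by (simp add: add_divide_distrib mult_ac)
qed

section \<open>Squared activations of a standard Gaussian vector and their Laplace transform\<close>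

definition prelu_sq :: "real \<Rightarrow> ('d::finite \<Rightarrow> real) \<Rightarrow> real" where
  "prelu_sq a z = (\<Sum>i\<in>UNIV. (prelu a (z i))\<^sup>2)"

text \<open>Vectors are plain functions on the index type here, so that independence of the
  coordinates is literally a product measure.\<close>

definition std_normal_vec :: "('d::finite \<Rightarrow> real) measure" where
  "std_normal_vec = PiM UNIV (\<lambda>_. std_normal)"

lemma prelu_sq_nonneg: "0 \<le> prelu_sq a z"
  by (simp add: prelu_sq_def sum_nonneg)

lemma prelu_sq_measurable [measurable]:
  "prelu_sq a \<in> borel_measurable (PiM (UNIV :: 'd::finite set) (\<lambda>_. borel))"
  unfolding prelu_sq_def[abs_def] by measurable

lemma sets_std_normal_vec [measurable_cong]:
  "sets (std_normal_vec :: ('d::finite \<Rightarrow> real) measure) = sets (PiM UNIV (\<lambda>_. borel))"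
  unfolding std_normal_vec_def by (intro sets_PiM_cong) auto

lemma prob_space_std_normal: "prob_space std_normal"
  by (rule prob_space_normal_density) simp

interpretation std_normal: prob_space std_normal
  by (rule prob_space_std_normal)

interpretation std_normal_prod: product_prob_space "\<lambda>_::'i. std_normal" UNIV
  by unfold_locales

interpretation std_normal_vec: prob_space "std_normal_vec :: ('d::finite \<Rightarrow> real) measure"
  unfolding std_normal_vec_def by (rule prob_space_PiM) (rule prob_space_std_normal)

text \<open>Distribute the factor \<open>prelu_sq\<close> over its summands. Each summand is a
  product over the coordinates in which one coordinate carries an extra square, so by independence
  it integrates to one factor of type \<open>k = 1\<close> and \<open>CARD('d) - 1\<close> factors
  of type \<open>k = 0\<close>. All summands give the same value.\<close>

lemma nn_integral_prelu_sq_Laplace: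
  fixes a t :: real
  assumes "t \<ge> 0"
  defines "\<alpha> \<equiv> (1 + 2 * t) powr (- 1/2)" and "\<beta> \<equiv> (1 + 2 * a\<^sup>2 * t) powr (- 1/2)"
  shows "(\<integral>\<^sup>+z. ennreal (prelu_sq a z * exp (- (t * prelu_sq a z))) \<partial>(std_normal_vec :: ('d::finite \<Rightarrow> real) measure))
    = ennreal (real CARD('d) * (\<alpha> ^ 3 + a\<^sup>2 * \<beta> ^ 3) * (\<alpha> + \<beta>) ^ (CARD('d) - 1) / 2 ^ CARD('d))"
proof -
  \<comment> \<open>The exponent marks coordinate \<open>i\<close> as the one with the extra square;
    all others get the power 0.\<close>
  let ?f = "\<lambda>i j y. ennreal (prelu a y ^ (2 * (if j = i then 1 else 0)) * exp (- (t * (prelu a y)\<^sup>2)))"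
  have pow: "x powr (-1 - 1/2) = (x powr (-1/2)) ^ 3" if "x > 0" for x :: real
  proof -
    have "(x powr (-1/2)) ^ 3 = (x powr (-1/2)) powr 3"
      using that by (subst powr_numeral[symmetric]) auto
    then show ?thesis by (simp add: powr_powr)
  qed
  have int: "(\<integral>\<^sup>+z. (\<Prod>j\<in>UNIV. ?f i j (z j)) \<partial>(std_normal_vec :: ('d \<Rightarrow> real) measure))
      = ennreal ((\<alpha> ^ 3 + a\<^sup>2 * \<beta> ^ 3) / 2 * ((\<alpha> + \<beta>) / 2) ^ (CARD('d) - 1))" for i :: 'd
  proof -
    have "1 + 2 * t > 0" "1 + 2 * a\<^sup>2 * t > 0" using assms(1) by (auto simp: add_pos_nonneg)
    then have one: "(\<integral>\<^sup>+y. ?f i j y \<partial>std_normal) =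
        (if j = i then ennreal ((\<alpha> ^ 3 + a\<^sup>2 * \<beta> ^ 3) / 2) else ennreal ((\<alpha> + \<beta>) / 2))" for j
      using nn_integral_prelu_Laplace[OF assms(1), of 1 a] nn_integral_prelu_Laplace[OF assms(1), of 0 a]
        pow[of "1 + 2 * t"] pow[of "1 + 2 * a\<^sup>2 * t"]
      unfolding \<alpha>_def \<beta>_def by simp
    have "(\<integral>\<^sup>+z. (\<Prod>j\<in>UNIV. ?f i j (z j)) \<partial>(std_normal_vec :: ('d \<Rightarrow> real) measure))
        = (\<Prod>j\<in>UNIV. \<integral>\<^sup>+y. ?f i j y \<partial>std_normal)"
      unfolding std_normal_vec_def by (rule std_normal_prod.product_nn_integral_prod) auto
    also have "\<dots> = ennreal ((\<alpha> ^ 3 + a\<^sup>2 * \<beta> ^ 3) / 2) * (\<Prod>j\<in>UNIV - {i}. ennreal ((\<alpha> + \<beta>) / 2))"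
      unfolding one by (subst prod.remove[of _ i]) (auto intro!: arg_cong2[of _ _ _ _ "(*)"] prod.cong)
    also have "\<dots> = ennreal ((\<alpha> ^ 3 + a\<^sup>2 * \<beta> ^ 3) / 2) * ennreal (((\<alpha> + \<beta>) / 2) ^ (CARD('d) - 1))"
      by (simp add: \<alpha>_def \<beta>_def ennreal_power)
    also have "\<dots> = ennreal ((\<alpha> ^ 3 + a\<^sup>2 * \<beta> ^ 3) / 2 * ((\<alpha> + \<beta>) / 2) ^ (CARD('d) - 1))"
      by (rule ennreal_mult''[symmetric]) (simp add: \<alpha>_def \<beta>_def)
    finally show ?thesis .
  qed
  have split: "ennreal (prelu_sq a z * exp (- (t * prelu_sq a z))) = (\<Sum>i\<in>UNIV. \<Prod>j\<in>UNIV. ?f i j (z j))"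
    for z :: "'d \<Rightarrow> real"
  proof -
    have "(\<Prod>j\<in>UNIV. ?f i j (z j)) = ennreal ((prelu a (z i))\<^sup>2 * exp (- (t * prelu_sq a z)))" for i
    proof -
      have "(\<Prod>j\<in>UNIV. prelu a (z j) ^ (2 * (if j = i then 1 else 0))) = (prelu a (z i))\<^sup>2"
        by (subst prod.remove[of _ i]) auto
      moreover have "(\<Prod>j\<in>UNIV. exp (- (t * (prelu a (z j))\<^sup>2))) = exp (- (t * prelu_sq a z))"
        by (simp add: prelu_sq_def exp_sum[symmetric] sum_negf sum_distrib_left)
      ultimately show ?thesis
        by (subst prod_ennreal) (auto simp: prod.distrib)
    qed
    then show ?thesis
      by (simp add: prelu_sq_def sum_distrib_right)
  qed
  have "(\<integral>\<^sup>+z. ennreal (prelu_sq a z * exp (- (t * prelu_sq a z))) \<partial>(std_normal_vec :: ('d \<Rightarrow> real) measure))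
      = (\<Sum>i\<in>UNIV. \<integral>\<^sup>+z. (\<Prod>j\<in>UNIV. ?f i j (z j)) \<partial>(std_normal_vec :: ('d \<Rightarrow> real) measure))"
    unfolding split by (rule nn_integral_sum) simp
  also have "\<dots> = ennreal (real CARD('d) * ((\<alpha> ^ 3 + a\<^sup>2 * \<beta> ^ 3) / 2 * ((\<alpha> + \<beta>) / 2) ^ (CARD('d) - 1)))"
    unfolding int by (simp add: ennreal_of_nat_eq_real_of_nat \<alpha>_def \<beta>_def flip: ennreal_mult'')
  also have "real CARD('d) * ((\<alpha> ^ 3 + a\<^sup>2 * \<beta> ^ 3) / 2 * ((\<alpha> + \<beta>) / 2) ^ (CARD('d) - 1))
      = real CARD('d) * (\<alpha> ^ 3 + a\<^sup>2 * \<beta> ^ 3) * (\<alpha> + \<beta>) ^ (CARD('d) - 1) / 2 ^ CARD('d)"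
  proof -
    have "CARD('d) = Suc (CARD('d) - 1)" by simp
    then have "(2::real) ^ CARD('d) = 2 * 2 ^ (CARD('d) - 1)" by (metis power_Suc)
    then show ?thesis by (simp add: power_divide field_simps)
  qed
  finally show ?thesis .
qed

section \<open>Moments of one layer\<close>

text \<open>The type argument supplies the dimension, which \<open>a\<close> and \<open>p\<close> do
  not determine. The value lives in \<open>ennreal\<close>, so that moments of arbitrary order can
  be handled before anything is known about finiteness.\<close>

definition prelu_moment :: "real \<Rightarrow> real \<Rightarrow> 'd::finite itself \<Rightarrow> ennreal" where
  "prelu_moment a p _ = (\<integral>\<^sup>+z. ennreal (prelu_sq a z powr (p / 2)) \<partial>(std_normal_vec :: ('d \<Rightarrow> real) measure))"

text \<open>The preceding Laplace formula at \<open>t = 0\<close>, where both half-line factors are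
  1.\<close>

lemma nn_integral_prelu_sq:
  "(\<integral>\<^sup>+z. ennreal (prelu_sq a z) \<partial>(std_normal_vec :: ('d::finite \<Rightarrow> real) measure))
     = ennreal ((1 + a\<^sup>2) * real CARD('d) / 2)"
proof -
  have "CARD('d) = Suc (CARD('d) - 1)" by simp
  then have "(2::real) ^ CARD('d) = 2 * 2 ^ (CARD('d) - 1)" by (metis power_Suc)
  then show ?thesis
    using nn_integral_prelu_sq_Laplace[of 0 a, where 'd = 'd] by (simp add: field_simps)
qed

lemma prelu_moment_2: "prelu_moment a 2 TYPE('d::finite) = ennreal ((1 + a\<^sup>2) * real CARD('d) / 2)"
  by (simp add: prelu_moment_def nn_integral_prelu_sq prelu_sq_nonneg abs_of_nonneg)

text \<open>Bound \<open>S powr (s/2)\<close> by \<open>1 + S\<close>, whose mean is finite. This is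
  what later forces the series in \<open>I_a\<close> to converge.\<close>

lemma prelu_moment_finite:
  assumes "0 < s" "s \<le> 2"
  shows "prelu_moment a s TYPE('d::finite) \<noteq> \<infinity>"
proof -
  have "prelu_sq a z powr (s / 2) \<le> 1 + prelu_sq a z" for z :: "'d \<Rightarrow> real"
  proof (cases "prelu_sq a z \<le> 1")
    case True
    then have "prelu_sq a z powr (s / 2) \<le> 1"
      using assms prelu_sq_nonneg[of a z] by (simp add: powr_le1)
    then show ?thesis using prelu_sq_nonneg[of a z] by linarith
  next
    case False
    then have "prelu_sq a z powr (s / 2) \<le> prelu_sq a z powr 1"
      using assms by (intro powr_mono) auto
    then show ?thesis using False by simp
  qed
  then have "prelu_moment a s TYPE('d) \<le>
      (\<integral>\<^sup>+z. 1 + ennreal (prelu_sq a z) \<partial>(std_normal_vec :: ('d \<Rightarrow> real) measure))"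
    unfolding prelu_moment_def
    by (intro nn_integral_mono) (simp add: prelu_sq_nonneg flip: ennreal_1 ennreal_plus)
  also have "\<dots> = 1 + ennreal ((1 + a\<^sup>2) * real CARD('d) / 2)"
    by (subst nn_integral_add) (simp_all add: nn_integral_prelu_sq std_normal_vec.emeasure_space_1)
  also have "\<dots> < \<infinity>" by simp
  finally show ?thesis by simp
qed

text \<open>The Gamma integral with exponent \<open>1 - q\<close> and rate \<open>S\<close> is
  \<open>Gamma (1 - q) * S powr (q - 1)\<close>; the prefactor \<open>S\<close> lifts the power to
  \<open>q\<close>. For \<open>S = 0\<close> both sides vanish.\<close>

lemma powr_Laplace_representation:
  fixes S q :: real
  assumes "S \<ge> 0" "0 < q" "q < 1"
  shows "ennreal (Gamma (1 - q)) * ennreal (S powr q) =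
    (\<integral>\<^sup>+t. ennreal (indicator {0..} t * t powr (- q)) * ennreal (S * exp (- (t * S))) \<partial>lborel)"
proof (cases "S = 0")
  case False
  with assms have S: "S > 0" by simp
  have "(\<integral>\<^sup>+t. ennreal (indicator {0..} t * t powr (- q)) * ennreal (S * exp (- (t * S))) \<partial>lborel)
      = (\<integral>\<^sup>+t. ennreal S * ennreal (indicator {0..} t * t powr ((1 - q) - 1) * exp (- (S * t))) \<partial>lborel)"
    using S by (intro nn_integral_cong) (auto simp: mult_ac simp flip: ennreal_mult')
  also have "\<dots> = ennreal S * ennreal (Gamma (1 - q) * S powr (- (1 - q)))"
    using nn_integral_Gamma_scaled[of "1 - q" S] assms S by (subst nn_integral_cmult) auto
  also have "\<dots> = ennreal (Gamma (1 - q)) * ennreal (S powr q)"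
    using assms S by (auto simp: powr_diff simp flip: ennreal_mult'')
  finally show ?thesis ..
qed simp

text \<open>With \<open>v = 2t/(1+2t)\<close> one has \<open>1 + 2a\<^sup>2t = (1 + 2t)(1 - (1 - a\<^sup>2)v)\<close>, and the negative powers
  of the last factor expand into binomial series in \<open>v\<close> with coefficients \<open>w_coef\<close>.\<close>

lemma Laplace_transform_expansion:
  fixes a t :: real
  assumes "0 < a" "a \<le> 1" "t \<ge> 0"
  defines "\<alpha> \<equiv> (1 + 2 * t) powr (- 1/2)" and "\<beta> \<equiv> (1 + 2 * a\<^sup>2 * t) powr (- 1/2)"
  shows "ennreal (real d * (\<alpha> ^ 3 + a\<^sup>2 * \<beta> ^ 3) * (\<alpha> + \<beta>) ^ (d - 1) / 2 ^ d) =
    (\<Sum>n\<le>d. ennreal (real (d choose n) / 2 ^ d) *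
       (\<Sum>k. ennreal (2 * w_coef a d k n) * ennreal ((2 * t / (1 + 2 * t)) ^ k * (1 + 2 * t) powr (- (real d / 2) - 1))))"
proof -
  define r where "r = (1 + 2 * a\<^sup>2 * t) / (1 + 2 * t)"
  have pos: "1 + 2 * t > 0" "1 + 2 * a\<^sup>2 * t > 0" using assms(3) by (auto simp: add_pos_nonneg)
  then have "r > 0" by (simp add: r_def)
  have \<beta>: "\<beta> = \<alpha> * r powr (- 1/2)"
    using pos by (simp add: \<alpha>_def \<beta>_def r_def powr_divide)
  have \<alpha>: "\<alpha> ^ m = (1 + 2 * t) powr (- (real m / 2))" for m
    using pos by (simp add: \<alpha>_def powr_power)
  have rpow: "(r powr (- 1/2)) ^ m = r powr (- (real m / 2))" for m
    using \<open>r > 0\<close> by (simp add: powr_power)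
  \<comment> \<open>Both monomials have total degree \<open>d + 2\<close> in \<alpha> and \<beta>.
    Pulling out \<open>\<alpha> ^ (d + 2)\<close>, which is the power of \<open>1 + 2 * t\<close> on
    the left, leaves exactly the two powers of \<open>r\<close> summed by
    \<open>w_coef_sums\<close>.\<close>
  have key: "(\<Sum>k. ennreal (2 * w_coef a d k n) * ennreal ((2 * t / (1 + 2 * t)) ^ k * (1 + 2 * t) powr (- (real d / 2) - 1)))
      = ennreal (real n * \<alpha> ^ (n + 2) * \<beta> ^ (d - n) + a\<^sup>2 * real (d - n) * \<alpha> ^ n * \<beta> ^ (d - n + 2))"
    if "n \<le> d" for n
  proof -
    let ?c = "(1 + 2 * t) powr (- (real d / 2) - 1)"
    let ?m = "real (d - n) / 2"
    have c: "?c = \<alpha> ^ (d + 2)" unfolding \<alpha> by (rule arg_cong[of _ _ "\<lambda>x. (1 + 2 * t) powr x"]) (simp add: field_simps)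
    have "(\<lambda>k. 2 * ?c * (w_coef a d k n * (2 * t / (1 + 2 * t)) ^ k)) sums
       (2 * ?c * (1/2 * (real n * r powr (- ?m) + a\<^sup>2 * real (d - n) * r powr (- ?m - 1))))"
      unfolding r_def by (intro sums_mult w_coef_sums assms)
    also have "2 * ?c * (1/2 * (real n * r powr (- ?m) + a\<^sup>2 * real (d - n) * r powr (- ?m - 1)))
        = real n * \<alpha> ^ (n + 2) * \<beta> ^ (d - n) + a\<^sup>2 * real (d - n) * \<alpha> ^ n * \<beta> ^ (d - n + 2)"
    proof -
      have r1: "r powr (- ?m) = (r powr (- 1/2)) ^ (d - n)" unfolding rpow ..
      have r2: "r powr (- ?m - 1) = (r powr (- 1/2)) ^ (d - n + 2)"
        unfolding rpow by (rule arg_cong[of _ _ "\<lambda>x. r powr x"]) (simp add: field_simps)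
      have "d + 2 = (n + 2) + (d - n)" using that by simp
      then have a1: "\<alpha> ^ (d + 2) = \<alpha> ^ (n + 2) * \<alpha> ^ (d - n)" by (metis power_add)
      have "d + 2 = n + (d - n + 2)" using that by simp
      then have a2: "\<alpha> ^ (d + 2) = \<alpha> ^ n * \<alpha> ^ (d - n + 2)" by (metis power_add)
      have "2 * ?c * (1/2 * (real n * r powr (- ?m) + a\<^sup>2 * real (d - n) * r powr (- ?m - 1)))
          = real n * (\<alpha> ^ (d + 2) * r powr (- ?m)) + a\<^sup>2 * real (d - n) * (\<alpha> ^ (d + 2) * r powr (- ?m - 1))"
        unfolding c by (simp add: algebra_simps)
      also have "\<alpha> ^ (d + 2) * r powr (- ?m) = \<alpha> ^ (n + 2) * \<beta> ^ (d - n)"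
        unfolding r1 a1 \<beta> power_mult_distrib by (rule mult.assoc)
      also have "\<alpha> ^ (d + 2) * r powr (- ?m - 1) = \<alpha> ^ n * \<beta> ^ (d - n + 2)"
        unfolding r2 a2 \<beta> power_mult_distrib by (rule mult.assoc)
      finally show ?thesis by (simp add: mult.assoc)
    qed
    finally have sums: "(\<lambda>k. 2 * ?c * (w_coef a d k n * (2 * t / (1 + 2 * t)) ^ k)) sums
      (real n * \<alpha> ^ (n + 2) * \<beta> ^ (d - n) + a\<^sup>2 * real (d - n) * \<alpha> ^ n * \<beta> ^ (d - n + 2))" .
    have nonneg: "0 \<le> 2 * ?c * (w_coef a d k n * (2 * t / (1 + 2 * t)) ^ k)" for k
      using assms w_coef_nonneg[of a d k n] by simp
    have "(\<Sum>k. ennreal (2 * ?c * (w_coef a d k n * (2 * t / (1 + 2 * t)) ^ k)))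
        = ennreal (real n * \<alpha> ^ (n + 2) * \<beta> ^ (d - n) + a\<^sup>2 * real (d - n) * \<alpha> ^ n * \<beta> ^ (d - n + 2))"
      using suminf_ennreal_eq[OF nonneg sums] .
    moreover have "ennreal (2 * ?c * (w_coef a d k n * (2 * t / (1 + 2 * t)) ^ k)) =
        ennreal (2 * w_coef a d k n) * ennreal ((2 * t / (1 + 2 * t)) ^ k * ?c)" for k
      using assms by (subst ennreal_mult''[symmetric]) (auto simp: mult_ac)
    ultimately show ?thesis by simp
  qed
  have nn: "\<alpha> \<ge> 0" "\<beta> \<ge> 0" by (auto simp: \<alpha>_def \<beta>_def)
  have "(\<Sum>n\<le>d. ennreal (real (d choose n) / 2 ^ d) *
       (\<Sum>k. ennreal (2 * w_coef a d k n) * ennreal ((2 * t / (1 + 2 * t)) ^ k * (1 + 2 * t) powr (- (real d / 2) - 1))))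
     = (\<Sum>n\<le>d. ennreal (real (d choose n) / 2 ^ d *
         (real n * \<alpha> ^ (n + 2) * \<beta> ^ (d - n) + a\<^sup>2 * real (d - n) * \<alpha> ^ n * \<beta> ^ (d - n + 2))))"
    using nn by (intro sum.cong refl) (subst ennreal_mult'', auto simp: key)
  also have "\<dots> = ennreal (\<Sum>n\<le>d. real (d choose n) / 2 ^ d *
         (real n * \<alpha> ^ (n + 2) * \<beta> ^ (d - n) + a\<^sup>2 * real (d - n) * \<alpha> ^ n * \<beta> ^ (d - n + 2)))"
    using nn by (intro sum_ennreal) auto
  also have "(\<Sum>n\<le>d. real (d choose n) / 2 ^ d *
         (real n * \<alpha> ^ (n + 2) * \<beta> ^ (d - n) + a\<^sup>2 * real (d - n) * \<alpha> ^ n * \<beta> ^ (d - n + 2)))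
     = (\<Sum>n\<le>d. real (d choose n) *
         (real n * \<alpha> ^ (n + 2) * \<beta> ^ (d - n) + a\<^sup>2 * real (d - n) * \<alpha> ^ n * \<beta> ^ (d - n + 2))) / 2 ^ d"
    by (simp add: sum_divide_distrib)
  finally show ?thesis unfolding binomial_size_bias ..
qed

text \<open>The case \<open>s = 2\<close> is separate because \<open>Gamma (1 - s/2)\<close> has a
  pole there. Otherwise the computation runs in \<open>ennreal\<close>, with exchanges justified by
  nonnegativity, and is translated to real series only at the end.\<close>

lemma prelu_moment_eq_I_a:
  assumes a: "0 < a" "a \<le> 1" and s: "0 < s" "s \<le> 2"
  shows "prelu_moment a s TYPE('d::finite) = ennreal (I_a a s CARD('d))"
proof (cases "s = 2")
  case True
  then show ?thesis by (simp add: prelu_moment_2 I_a_def)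
next
  case False
  define q where "q = s / 2"
  define d where "d = CARD('d)"
  have q: "0 < q" "q < 1" using s False by (auto simp: q_def)
  have d: "d > 0" by (simp add: d_def)
  have G: "Gamma (1 - q) > 0" using q by (intro Gamma_real_pos) simp
  let ?N = "std_normal_vec :: ('d \<Rightarrow> real) measure"
  interpret P: pair_sigma_finite ?N lborel ..
  define X where "X n k = w_coef a d k n * Beta (real k + 1 - q) (real d / 2 + q)" for n k
  have Xnn: "0 \<le> X n k" for n k
    using w_coef_nonneg[OF a, of d k n] q d by (simp add: X_def Beta_def)
  let ?K = "\<lambda>k t::real. ennreal (indicator {0..} t * t powr (- q) * (2 * t / (1 + 2 * t)) ^ k * (1 + 2 * t) powr (- (real d / 2) - 1))"
  have "ennreal (Gamma (1 - q)) * prelu_moment a s TYPE('d) =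
      (\<integral>\<^sup>+z. ennreal (Gamma (1 - q)) * ennreal (prelu_sq a z powr q) \<partial>?N)"
    unfolding prelu_moment_def q_def by (rule nn_integral_cmult[symmetric]) simp
  also have "\<dots> = (\<integral>\<^sup>+z. (\<integral>\<^sup>+t. ennreal (indicator {0..} t * t powr (- q)) *
      ennreal (prelu_sq a z * exp (- (t * prelu_sq a z))) \<partial>lborel) \<partial>?N)"
    by (intro nn_integral_cong powr_Laplace_representation q prelu_sq_nonneg)
  also have "\<dots> = (\<integral>\<^sup>+t. (\<integral>\<^sup>+z. ennreal (indicator {0..} t * t powr (- q)) *
      ennreal (prelu_sq a z * exp (- (t * prelu_sq a z))) \<partial>?N) \<partial>lborel)"
    by (rule P.Fubini'[symmetric]) measurable
  also have "\<dots> = (\<integral>\<^sup>+t. (\<Sum>n\<le>d. ennreal (real (d choose n) / 2 ^ d) *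
       (\<Sum>k. ennreal (2 * w_coef a d k n) * ?K k t)) \<partial>lborel)"
  proof (intro nn_integral_cong)
    fix t :: real
    show "(\<integral>\<^sup>+z. ennreal (indicator {0..} t * t powr (- q)) *
        ennreal (prelu_sq a z * exp (- (t * prelu_sq a z))) \<partial>?N)
      = (\<Sum>n\<le>d. ennreal (real (d choose n) / 2 ^ d) * (\<Sum>k. ennreal (2 * w_coef a d k n) * ?K k t))"
    proof (cases "t \<ge> 0")
      case True
      have "(\<integral>\<^sup>+z. ennreal (indicator {0..} t * t powr (- q)) *
          ennreal (prelu_sq a z * exp (- (t * prelu_sq a z))) \<partial>?N)
        = ennreal (t powr (- q)) * (\<Sum>n\<le>d. ennreal (real (d choose n) / 2 ^ d) *
       (\<Sum>k. ennreal (2 * w_coef a d k n) * ennreal ((2 * t / (1 + 2 * t)) ^ k * (1 + 2 * t) powr (- (real d / 2) - 1))))"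
        using True nn_integral_prelu_sq_Laplace[OF True, of a, where 'd = 'd]
          Laplace_transform_expansion[OF a True, of d]
        by (subst nn_integral_cmult) (auto simp: d_def)
      also have "\<dots> = (\<Sum>n\<le>d. ennreal (real (d choose n) / 2 ^ d) * (\<Sum>k. ennreal (t powr (- q)) *
         (ennreal (2 * w_coef a d k n) * ennreal ((2 * t / (1 + 2 * t)) ^ k * (1 + 2 * t) powr (- (real d / 2) - 1)))))"
        by (simp add: sum_distrib_left ennreal_suminf_cmult mult.left_commute)
      also have "\<dots> = (\<Sum>n\<le>d. ennreal (real (d choose n) / 2 ^ d) * (\<Sum>k. ennreal (2 * w_coef a d k n) * ?K k t))"
      proof -
        have "ennreal (t powr (- q)) * (ennreal (2 * w_coef a d k n) *
            ennreal ((2 * t / (1 + 2 * t)) ^ k * (1 + 2 * t) powr (- (real d / 2) - 1)))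
          = ennreal (2 * w_coef a d k n) * ?K k t" for k n
          using True by (simp add: ennreal_mult' mult_ac)
        then show ?thesis by simp
      qed
      finally show ?thesis .
    qed simp
  qed
  \<comment> \<open>Monotone convergence moves the integral inside the infinite series.\<close>
  also have "\<dots> = (\<Sum>n\<le>d. ennreal (real (d choose n) / 2 ^ d) *
       (\<Sum>k. ennreal (2 * w_coef a d k n) * (\<integral>\<^sup>+t. ?K k t \<partial>lborel)))"
    by (simp add: nn_integral_sum nn_integral_cmult nn_integral_suminf)
  also have "\<dots> = (\<Sum>n\<le>d. ennreal (real (d choose n) / 2 ^ d) * (\<Sum>k. ennreal (2 powr q) * ennreal (X n k)))"
  proof -
    have "(\<integral>\<^sup>+t. ?K k t \<partial>lborel) = ennreal (2 powr q / 2 * Beta (real k + 1 - q) (real d / 2 + q))" for k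
      using nn_integral_Beta_kernel[OF q, of "real d / 2" k] d by simp
    then have "ennreal (2 * w_coef a d k n) * (\<integral>\<^sup>+t. ?K k t \<partial>lborel) = ennreal (2 powr q) * ennreal (X n k)" for n k
      using q d w_coef_nonneg[OF a, of d k n]
      by (simp add: X_def Beta_def mult_ac flip: ennreal_mult'')
    then show ?thesis by simp
  qed
  finally have main: "ennreal (Gamma (1 - q)) * prelu_moment a s TYPE('d) =
    ennreal (2 powr q) * (\<Sum>n\<le>d. ennreal (real (d choose n) / 2 ^ d) * (\<Sum>k. ennreal (X n k)))"
    by (simp add: sum_distrib_left ennreal_suminf_cmult mult.left_commute)
  \<comment> \<open>Convergence of the inner series is deduced backwards from the finite moment.
    Without it the real \<open>suminf\<close> in \<open>I_a\<close> would not represent the extended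
    sum.\<close>
  have "ennreal (Gamma (1 - q)) * prelu_moment a s TYPE('d) \<noteq> \<infinity>"
    using prelu_moment_finite[OF s, of a, where 'd = 'd] by (simp add: ennreal_mult_eq_top_iff)
  then have "(\<Sum>n\<le>d. ennreal (real (d choose n) / 2 ^ d) * (\<Sum>k. ennreal (X n k))) \<noteq> \<infinity>"
    unfolding main by (auto simp: ennreal_mult_eq_top_iff)
  then have fin: "(\<Sum>k. ennreal (X n k)) \<noteq> \<infinity>" if "n \<le> d" for n
    using that by (auto simp: ennreal_sum_eq_top ennreal_mult_eq_top_iff)
  have Xsum: "(\<Sum>k. ennreal (X n k)) = ennreal (\<Sum>k. X n k)" if "n \<le> d" for n
    using fin[OF that] Xnn by (intro suminf_ennreal) auto
  have Xsum_nn: "0 \<le> (\<Sum>k. X n k)" if "n \<le> d" for n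
    using fin[OF that] Xnn by (intro suminf_nonneg summable_suminf_not_top) auto
  have "(\<Sum>n\<le>d. ennreal (real (d choose n) / 2 ^ d) * (\<Sum>k. ennreal (X n k)))
      = (\<Sum>n\<le>d. ennreal (real (d choose n) / 2 ^ d * (\<Sum>k. X n k)))"
    using Xsum Xsum_nn by (intro sum.cong refl) (auto simp flip: ennreal_mult'')
  also have "\<dots> = ennreal (\<Sum>n\<le>d. real (d choose n) / 2 ^ d * (\<Sum>k. X n k))"
    using Xsum_nn by (intro sum_ennreal) auto
  finally have "ennreal (Gamma (1 - q)) * prelu_moment a s TYPE('d) =
      ennreal (2 powr q) * ennreal (\<Sum>n\<le>d. real (d choose n) / 2 ^ d * (\<Sum>k. X n k))"
    unfolding main by simp
  then have "ennreal (1 / Gamma (1 - q)) * (ennreal (Gamma (1 - q)) * prelu_moment a s TYPE('d)) =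
      ennreal (1 / Gamma (1 - q) * (2 powr q * (\<Sum>n\<le>d. real (d choose n) / 2 ^ d * (\<Sum>k. X n k))))"
    using G by (simp flip: ennreal_mult')
  moreover have "ennreal (1 / Gamma (1 - q)) * ennreal (Gamma (1 - q)) = 1"
    using G by (simp flip: ennreal_mult'')
  ultimately have "prelu_moment a s TYPE('d) =
      ennreal (1 / Gamma (1 - q) * (2 powr q * (\<Sum>n\<le>d. real (d choose n) / 2 ^ d * (\<Sum>k. X n k))))"
    by (simp add: mult.assoc[symmetric])
  also have "1 / Gamma (1 - q) * (2 powr q * (\<Sum>n\<le>d. real (d choose n) / 2 ^ d * (\<Sum>k. X n k))) = I_a a s d"
    using False by (simp add: I_a_def X_def q_def atLeast0AtMost)
  finally show ?thesis by (simp add: d_def)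
qed

text \<open>A coordinate above \<open>\<bar>c\<bar> + 1\<close> already pushes
  \<open>prelu_sq\<close> above \<open>c\<close>, and a Gaussian exceeds every bound with positive
  probability. This gives both the positivity of \<open>I_a\<close> and the strictness of the moment
  inequality at critical variance.\<close>

lemma prelu_sq_not_AE_const:
  "\<not> (AE z in (std_normal_vec :: ('d::finite \<Rightarrow> real) measure). prelu_sq a z = c)"
proof
  fix i :: 'd
  assume AE: "AE z in (std_normal_vec :: ('d \<Rightarrow> real) measure). prelu_sq a z = c"
  define B where "B = \<bar>c\<bar> + 1"
  have "z i \<le> B" if "prelu_sq a z = c" for z :: "'d \<Rightarrow> real"
  proof (rule ccontr)
    assume "\<not> z i \<le> B"
    then have zi: "z i > B" "z i > 1" by (auto simp: B_def)
    then have "c < z i * 1" by (simp add: B_def)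
    also have "\<dots> \<le> z i * z i" using zi by (intro mult_left_mono) auto
    also have "\<dots> = (prelu a (z i))\<^sup>2" using zi by (simp add: prelu_def power2_eq_square)
    also have "\<dots> \<le> prelu_sq a z"
      unfolding prelu_sq_def by (rule member_le_sum) auto
    finally show False using that by simp
  qed
  with AE have "AE z in (std_normal_vec :: ('d \<Rightarrow> real) measure). z i \<le> B"
    by (auto elim: eventually_mono)
  then have "AE x in distr (std_normal_vec :: ('d \<Rightarrow> real) measure) std_normal (\<lambda>z. z i). x \<le> B"
    by (subst AE_distr_iff) (auto simp: std_normal_vec_def)
  then have "AE x in std_normal. x \<le> B"
    unfolding std_normal_vec_def
    by (subst (asm) distr_PiM_component) (auto intro: prob_space_std_normal)
  then have "AE x in lborel. x \<le> B"
    by (subst (asm) AE_density) (auto simp: normal_density_pos)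
  then have "emeasure lborel {B<..} = 0"
    by (subst (asm) AE_iff_measurable[OF _ refl]) (auto simp: not_le greaterThan_def)
  moreover have "emeasure lborel {B<..B+1} \<le> emeasure lborel {B<..}"
    by (intro emeasure_mono) auto
  ultimately show False by simp
qed

section \<open>Recursion over the layers\<close>

lemma sets_weight_space [measurable_cong]:
  "sets (weight_space \<sigma> :: (nat \<times> 'd \<times> 'd \<Rightarrow> real) measure) = sets (PiM UNIV (\<lambda>_. borel))"
  unfolding weight_space_def by (intro sets_PiM_cong) auto

lemma prob_space_weight_space:
  "0 < \<sigma> \<Longrightarrow> prob_space (weight_space \<sigma> :: (nat \<times> 'd \<times> 'd \<Rightarrow> real) measure)"
  unfolding weight_space_def by (intro prob_space_PiM prob_space_normal_density)

lemma distributed_weight: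
  fixes i :: "nat \<times> 'd \<times> 'd"
  assumes "0 < \<sigma>"
  shows "distributed (weight_space \<sigma>) lborel (\<lambda>w. w i) (normal_density 0 \<sigma>)"
proof -
  have "distr (weight_space \<sigma>) lborel (\<lambda>w. w i) =
      distr (weight_space \<sigma>) (density lborel (normal_density 0 \<sigma>)) (\<lambda>w. w i)"
    by (rule distr_cong) auto
  also have "\<dots> = density lborel (normal_density 0 \<sigma>)"
    unfolding weight_space_def
    using distr_PiM_component[of UNIV "\<lambda>_. density lborel (normal_density 0 \<sigma>)" i] assms
    by (simp add: prob_space_normal_density)
  finally show ?thesis unfolding distributed_def by simp
qed

text \<open>Independence means that the joint law is the product of the marginals; here the joint
  map is the identity and the measure is a product by construction.\<close>

lemma indep_vars_weights:
  assumes "0 < \<sigma>"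
  shows "prob_space.indep_vars (weight_space \<sigma> :: (nat \<times> 'd \<times> 'd \<Rightarrow> real) measure)
    (\<lambda>_. borel) (\<lambda>i w. w i) UNIV"
proof -
  interpret prob_space "weight_space \<sigma> :: (nat \<times> 'd \<times> 'd \<Rightarrow> real) measure"
    by (rule prob_space_weight_space[OF assms])
  have "distr (weight_space \<sigma>) borel (\<lambda>w. w i) = density lborel (normal_density 0 \<sigma>)"
    for i :: "nat \<times> 'd \<times> 'd"
  proof -
    have "distr (weight_space \<sigma>) borel (\<lambda>w. w i) = distr (weight_space \<sigma>) lborel (\<lambda>w. w i)"
      by (rule distr_cong) auto
    then show ?thesis using distributed_weight[OF assms, of i] by (simp add: distributed_def)
  qed
  moreover have "distr (weight_space \<sigma>) (PiM UNIV (\<lambda>_. borel)) (\<lambda>x. \<lambda>i\<in>UNIV. x i)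
      = (weight_space \<sigma> :: (nat \<times> 'd \<times> 'd \<Rightarrow> real) measure)"
    by (simp add: restrict_UNIV distr_id2 sets_weight_space)
  ultimately show ?thesis
    by (subst indep_vars_iff_distr_eq_PiM) (auto simp: weight_space_def)
qed

text \<open>Variances of independent Gaussians add, and the squares of the entries of
  \<open>x\<close> sum to its squared norm.\<close>

lemma distributed_row_product:
  fixes x :: "real ^ 'd" and i :: 'd
  assumes "0 < \<sigma>" "x \<noteq> 0"
  shows "distributed (weight_space \<sigma>) lborel (\<lambda>w. \<Sum>j\<in>UNIV. w (k, i, j) * x $ j)
    (normal_density 0 (\<sigma> * norm x))"
proof -
  interpret prob_space "weight_space \<sigma> :: (nat \<times> 'd \<times> 'd \<Rightarrow> real) measure"
    by (rule prob_space_weight_space[OF assms(1)])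
  \<comment> \<open>A zero entry would give a summand of variance 0, which has no normal density, so
    only the nonzero entries are kept.\<close>
  define J where "J = {j. x $ j \<noteq> 0}"
  have "J \<noteq> {}" using assms(2) by (auto simp: J_def vec_eq_iff)
  have "indep_vars (\<lambda>j. PiM {(k, i, j)} (\<lambda>_. borel)) (\<lambda>j w. restrict (\<lambda>l. w l) {(k, i, j)}) J"
    by (rule indep_vars_restrict[OF indep_vars_weights[OF assms(1)]]) (auto simp: disjoint_family_on_def)
  then have "indep_vars (\<lambda>j. borel) (\<lambda>j w. x $ j * restrict (\<lambda>l. w l) {(k, i, j)} (k, i, j)) J"
    by (rule indep_vars_compose2[where Y = "\<lambda>j f. x $ j * f (k, i, j)"]) measurable
  then have indep: "indep_vars (\<lambda>j. borel) (\<lambda>j w. x $ j * w (k, i, j)) J"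
    by simp
  have normal: "distributed (weight_space \<sigma>) lborel (\<lambda>w. x $ j * w (k, i, j)) (normal_density 0 (\<bar>x $ j\<bar> * \<sigma>))"
    if "j \<in> J" for j
    using normal_density_affine[OF distributed_weight[OF assms(1)], of "x $ j" 0] that assms(1)
    by (simp add: J_def)
  have "distributed (weight_space \<sigma>) lborel (\<lambda>w. \<Sum>j\<in>J. x $ j * w (k, i, j))
      (normal_density (\<Sum>j\<in>J. 0) (sqrt (\<Sum>j\<in>J. (\<bar>x $ j\<bar> * \<sigma>)\<^sup>2)))"
    using \<open>J \<noteq> {}\<close> assms(1) by (intro sum_indep_normal indep normal) (auto simp: J_def)
  moreover have "(\<Sum>j\<in>J. x $ j * w (k, i, j)) = (\<Sum>j\<in>UNIV. w (k, i, j) * x $ j)" for w :: "nat \<times> 'd \<times> 'd \<Rightarrow> real"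
    by (rule sum.mono_neutral_cong_left) (auto simp: J_def)
  moreover have "sqrt (\<Sum>j\<in>J. (\<bar>x $ j\<bar> * \<sigma>)\<^sup>2) = \<sigma> * norm x"
  proof -
    have "(\<Sum>j\<in>J. (\<bar>x $ j\<bar> * \<sigma>)\<^sup>2) = (\<Sum>j\<in>UNIV. (\<bar>x $ j\<bar> * \<sigma>)\<^sup>2)"
      by (rule sum.mono_neutral_left) (auto simp: J_def)
    also have "\<dots> = \<sigma>\<^sup>2 * (\<Sum>j\<in>UNIV. (x $ j)\<^sup>2)"
      by (simp add: sum_distrib_left power_mult_distrib mult.commute)
    finally show ?thesis using assms(1) by (simp add: norm_vec_def L2_set_def real_sqrt_mult)
  qed
  ultimately show ?thesis by simp
qed

text \<open>Different rows use disjoint blocks of weights and are therefore independent; dividing by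
  the standard deviation makes each of them standard normal. The resulting law does not depend on
  the direction of \<open>x\<close>.\<close>

lemma distr_normalized_layer:
  fixes x :: "real ^ 'd"
  assumes "0 < \<sigma>" "x \<noteq> 0"
  shows "distr (weight_space \<sigma>) (PiM UNIV (\<lambda>_. borel))
      (\<lambda>w. \<lambda>i\<in>UNIV. (\<Sum>j\<in>UNIV. w (k, i, j) * x $ j) / (\<sigma> * norm x)) = (std_normal_vec :: ('d \<Rightarrow> real) measure)"
proof -
  interpret prob_space "weight_space \<sigma> :: (nat \<times> 'd \<times> 'd \<Rightarrow> real) measure"
    by (rule prob_space_weight_space[OF assms(1)])
  let ?V = "\<lambda>(i::'d) w. (\<Sum>j\<in>UNIV. w (k, i, j) * x $ j) / (\<sigma> * norm x)"
  let ?K = "\<lambda>i::'d. {k} \<times> {i} \<times> (UNIV :: 'd set)"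
  have "indep_vars (\<lambda>i. PiM (?K i) (\<lambda>_. borel)) (\<lambda>i w. restrict (\<lambda>l. w l) (?K i)) UNIV"
    by (rule indep_vars_restrict[OF indep_vars_weights[OF assms(1)]]) (auto simp: disjoint_family_on_def)
  then have "indep_vars (\<lambda>i. borel) (\<lambda>i w. ?V i (restrict (\<lambda>l. w l) (?K i))) UNIV"
  proof (rule indep_vars_compose2)
    fix i :: 'd
    have "(\<lambda>w. w (k, i, j)) \<in> borel_measurable (PiM (?K i) (\<lambda>_. borel))" for j
      by (rule measurable_component_singleton) auto
    then show "?V i \<in> borel_measurable (PiM (?K i) (\<lambda>_. borel))"
      by measurable
  qed
  then have "indep_vars (\<lambda>i. borel) ?V UNIV"
    by simp
  then have "distr (weight_space \<sigma>) (PiM UNIV (\<lambda>_. borel)) (\<lambda>w. \<lambda>i\<in>UNIV. ?V i w)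
      = PiM UNIV (\<lambda>i. distr (weight_space \<sigma>) borel (?V i))"
    by (subst (asm) indep_vars_iff_distr_eq_PiM) auto
  moreover have "distr (weight_space \<sigma>) borel (?V i) = std_normal" for i
  proof -
    have "distributed (weight_space \<sigma>) lborel (?V i) std_normal_density"
      using distributed_row_product[OF assms, of k i] assms
      by (subst (asm) normal_standard_normal_convert) auto
    then have "distr (weight_space \<sigma>) lborel (?V i) = std_normal"
      by (simp add: distributed_def)
    moreover have "distr (weight_space \<sigma>) borel (?V i) = distr (weight_space \<sigma>) lborel (?V i)"
      by (rule distr_cong) auto
    ultimately show ?thesis by simp
  qed
  ultimately show ?thesis by (simp add: std_normal_vec_def)
qed

text \<open>Positive homogeneity of \<open>prelu\<close> pulls the scale
  \<open>\<sigma> * norm x\<close> out of the norm, and what remains is a function of the normalized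
  Gaussian vector alone.\<close>

lemma nn_integral_one_layer:
  fixes x :: "real ^ 'd"
  assumes "0 < \<sigma>"
  shows "(\<integral>\<^sup>+w. ennreal (norm (\<chi> i. prelu a (\<Sum>j\<in>UNIV. w (k, i, j) * x $ j)) powr p) \<partial>weight_space \<sigma>)
    = ennreal (norm x powr p) * (ennreal (\<sigma> powr p) * prelu_moment a p TYPE('d))"
proof (cases "x = 0")
  \<comment> \<open>\<open>0 powr p\<close> is 0 for every \<open>p\<close>, so both sides
    vanish.\<close>
  case True
  have "(\<chi> i. prelu a (\<Sum>j\<in>UNIV. w (k, i, j) * x $ j)) = 0" for w :: "nat \<times> 'd \<times> 'd \<Rightarrow> real"
    by (simp add: True prelu_def vec_eq_iff)
  then show ?thesis by (simp add: True)
next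
  case False
  define \<tau> where "\<tau> = \<sigma> * norm x"
  have \<tau>: "\<tau> > 0" using assms False by (simp add: \<tau>_def)
  let ?V = "\<lambda>w. \<lambda>i\<in>(UNIV :: 'd set). (\<Sum>j\<in>UNIV. w (k, i, j) * x $ j) / \<tau>"
  have eq: "norm (\<chi> i. prelu a (\<Sum>j\<in>UNIV. w (k, i, j) * x $ j)) powr p = \<tau> powr p * prelu_sq a (?V w) powr (p / 2)"
    for w :: "nat \<times> 'd \<times> 'd \<Rightarrow> real"
  proof -
    have "\<tau>\<^sup>2 * (prelu a (y / \<tau>))\<^sup>2 = (prelu a y)\<^sup>2" for y
      using \<tau> by (simp add: prelu_def zero_less_divide_iff power_mult_distrib power_divide)
    then have "norm (\<chi> i. prelu a (\<Sum>j\<in>UNIV. w (k, i, j) * x $ j)) = sqrt (\<tau>\<^sup>2 * prelu_sq a (?V w))"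
      unfolding norm_vec_def L2_set_def prelu_sq_def sum_distrib_left by simp
    also have "\<dots> = \<tau> * prelu_sq a (?V w) powr (1 / 2)"
      using \<tau> by (simp add: real_sqrt_mult powr_half_sqrt prelu_sq_nonneg)
    finally show ?thesis using \<tau> by (simp add: powr_mult powr_powr)
  qed
  have "(\<integral>\<^sup>+w. ennreal (norm (\<chi> i. prelu a (\<Sum>j\<in>UNIV. w (k, i, j) * x $ j)) powr p) \<partial>weight_space \<sigma>)
      = ennreal (\<tau> powr p) * (\<integral>\<^sup>+w. ennreal (prelu_sq a (?V w) powr (p / 2)) \<partial>weight_space \<sigma>)"
    unfolding eq by (subst nn_integral_cmult[symmetric]) (auto simp: ennreal_mult')
  also have "(\<integral>\<^sup>+w. ennreal (prelu_sq a (?V w) powr (p / 2)) \<partial>weight_space \<sigma>) =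
      (\<integral>\<^sup>+z. ennreal (prelu_sq a z powr (p / 2)) \<partial>distr (weight_space \<sigma>) (PiM UNIV (\<lambda>_. borel)) ?V)"
    by (rule nn_integral_distr[symmetric]) measurable
  also have "\<dots> = prelu_moment a p TYPE('d)"
    using distr_normalized_layer[OF assms False, of k] by (simp add: prelu_moment_def \<tau>_def)
  finally show ?thesis
    using assms by (simp add: \<tau>_def powr_mult ennreal_mult' mult_ac)
qed

section \<open>Independence of successive layers and the moment recursion\<close>

lemma layer_cong:
  assumes "\<And>l i j. l < k \<Longrightarrow> w (l, i, j) = w' (l, i, j)"
  shows "layer a x0 w k = layer a x0 w' k"
  using assms by (induction k) simp_all

text \<open>The index set is left general so that measurability is available with respect to the
  first \<open>k\<close> matrices alone, as the independence argument needs.\<close>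

lemma layer_component_measurable:
  fixes x0 :: "real ^ 'd"
  assumes "{..<k} \<times> UNIV \<subseteq> A"
  shows "(\<lambda>w. layer a x0 w k $ i) \<in> borel_measurable (PiM A (\<lambda>_. borel))"
  using assms
proof (induction k arbitrary: i)
  case (Suc k)
  have [measurable]: "(\<lambda>w. layer a x0 w k $ j) \<in> borel_measurable (PiM A (\<lambda>_. borel))" for j
    using Suc.prems by (intro Suc.IH) auto
  have [measurable]: "(\<lambda>w. w (k, i, j)) \<in> borel_measurable (PiM A (\<lambda>_. borel))" for i j
    using Suc.prems by (intro measurable_component_singleton) auto
  show ?case by simp
qed simp

lemma norm_vec_measurable:
  fixes f :: "'a \<Rightarrow> real ^ 'd"
  assumes [measurable]: "\<And>i. (\<lambda>x. f x $ i) \<in> borel_measurable M"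
  shows "(\<lambda>x. norm (f x)) \<in> borel_measurable M"
  unfolding norm_vec_def L2_set_def by measurable

text \<open>The current layer and the next matrix are functions of disjoint, hence independent,
  blocks of weights. Under the product law the old layer can be frozen, and
  \<open>nn_integral_one_layer\<close> then applies to it as a deterministic input.\<close>

lemma moment_Suc:
  fixes x0 :: "real ^ 'd"
  assumes "0 < \<sigma>"
  shows "moment a \<sigma> x0 p (Suc k) = moment a \<sigma> x0 p k * (ennreal (\<sigma> powr p) * prelu_moment a p TYPE('d))"
proof -
  let ?W = "weight_space \<sigma> :: (nat \<times> 'd \<times> 'd \<Rightarrow> real) measure"
  interpret prob_space ?W by (rule prob_space_weight_space[OF assms])
  \<comment> \<open>Layer \<open>k\<close> reads only matrix indices below \<open>k\<close>; the
    index \<open>k\<close> itself stands for the matrix W^(k+1) that produces the next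
    layer.\<close>
  define A :: "(nat \<times> 'd \<times> 'd) set" where "A = {..<k} \<times> UNIV"
  define B :: "(nat \<times> 'd \<times> 'd) set" where "B = {k} \<times> UNIV"
  let ?MA = "PiM A (\<lambda>_. borel :: real measure)" and ?MB = "PiM B (\<lambda>_. borel :: real measure)"
  let ?X = "\<lambda>w. restrict (\<lambda>l. w l) A" and ?Y = "\<lambda>w. restrict (\<lambda>l. w l) B"
  define F where "F u v = ennreal (norm (\<chi> i. prelu a (\<Sum>j\<in>UNIV. v (k, i, j) * (layer a x0 u k $ j))) powr p)"
    for u v :: "nat \<times> 'd \<times> 'd \<Rightarrow> real"
  have lay [measurable]: "(\<lambda>u. layer a x0 u k $ j) \<in> borel_measurable ?MA" for j
    by (rule layer_component_measurable) (simp add: A_def)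
  have [measurable]: "(\<lambda>v. v (k, i, j)) \<in> borel_measurable ?MB" for i j
    by (rule measurable_component_singleton) (simp add: B_def)
  have [measurable]: "(\<lambda>u. norm (layer a x0 u k)) \<in> borel_measurable ?MA"
    by (rule norm_vec_measurable) measurable
  have "(\<lambda>y. norm (\<chi> i. prelu a (\<Sum>j\<in>UNIV. snd y (k, i, j) * (layer a x0 (fst y) k $ j))))
      \<in> borel_measurable (?MA \<Otimes>\<^sub>M ?MB)"
    by (rule norm_vec_measurable) simp
  then have F_meas: "(\<lambda>y. F (fst y) (snd y)) \<in> borel_measurable (?MA \<Otimes>\<^sub>M ?MB)"
    unfolding F_def by measurable
  have coord: "(\<lambda>w. w l) \<in> borel_measurable ?W" for l
    unfolding measurable_cong_sets[OF sets_weight_space refl] by (rule measurable_component_singleton) simp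
  have [measurable]: "?X \<in> measurable ?W ?MA"
    by (rule measurable_restrict) (rule coord)
  have [measurable]: "?Y \<in> measurable ?W ?MB"
    by (rule measurable_restrict) (rule coord)
  have "indep_var ?MA ?X ?MB ?Y"
    by (rule indep_var_restrict[OF indep_vars_weights[OF assms]]) (auto simp: A_def B_def)
  then have pair: "distr ?W (?MA \<Otimes>\<^sub>M ?MB) (\<lambda>w. (?X w, ?Y w)) = distr ?W ?MA ?X \<Otimes>\<^sub>M distr ?W ?MB ?Y"
    by (simp add: indep_var_distribution_eq)
  interpret Y: prob_space "distr ?W ?MB ?Y" by (rule prob_space_distr) measurable
  have layX: "layer a x0 (?X w) k = layer a x0 w k" for w
    by (rule layer_cong) (simp add: A_def)
  have "moment a \<sigma> x0 p (Suc k) = (\<integral>\<^sup>+w. F (?X w) (?Y w) \<partial>?W)"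
    unfolding moment_def F_def layX by (simp add: B_def)
  also have "\<dots> = (\<integral>\<^sup>+y. F (fst y) (snd y) \<partial>distr ?W (?MA \<Otimes>\<^sub>M ?MB) (\<lambda>w. (?X w, ?Y w)))"
    using F_meas by (subst nn_integral_distr) auto
  also have "\<dots> = (\<integral>\<^sup>+u. (\<integral>\<^sup>+v. F u v \<partial>distr ?W ?MB ?Y) \<partial>distr ?W ?MA ?X)"
    unfolding pair using F_meas
    by (subst Y.nn_integral_fst[symmetric]) (auto cong: measurable_cong_sets sets_pair_measure_cong)
  also have "\<dots> = (\<integral>\<^sup>+u. ennreal (norm (layer a x0 u k) powr p) *
      (ennreal (\<sigma> powr p) * prelu_moment a p TYPE('d)) \<partial>distr ?W ?MA ?X)"
  proof (intro nn_integral_cong)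
    fix u assume "u \<in> space (distr ?W ?MA ?X)"
    have "(\<lambda>v. norm (\<chi> i. prelu a (\<Sum>j\<in>UNIV. v (k, i, j) * (layer a x0 u k $ j)))) \<in> borel_measurable ?MB"
      by (rule norm_vec_measurable) simp
    then have "F u \<in> borel_measurable ?MB"
      unfolding F_def by measurable
    then have "(\<integral>\<^sup>+v. F u v \<partial>distr ?W ?MB ?Y) = (\<integral>\<^sup>+w. F u (?Y w) \<partial>?W)"
      by (intro nn_integral_distr) auto
    also have "\<dots> = (\<integral>\<^sup>+w. ennreal (norm (\<chi> i. prelu a (\<Sum>j\<in>UNIV. w (k, i, j) * (layer a x0 u k $ j))) powr p) \<partial>?W)"
      by (simp add: F_def B_def)
    finally show "(\<integral>\<^sup>+v. F u v \<partial>distr ?W ?MB ?Y) = ennreal (norm (layer a x0 u k) powr p) *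
        (ennreal (\<sigma> powr p) * prelu_moment a p TYPE('d))"
      using nn_integral_one_layer[OF assms, of a k "layer a x0 u k" p] by simp
  qed
  also have "\<dots> = (\<integral>\<^sup>+u. ennreal (norm (layer a x0 u k) powr p) \<partial>distr ?W ?MA ?X) *
      (ennreal (\<sigma> powr p) * prelu_moment a p TYPE('d))"
    by (rule nn_integral_multc) simp
  also have "(\<integral>\<^sup>+u. ennreal (norm (layer a x0 u k) powr p) \<partial>distr ?W ?MA ?X) = moment a \<sigma> x0 p k"
    unfolding moment_def by (subst nn_integral_distr) (auto simp: layX)
  finally show ?thesis .
qed

lemma moment_eq_power:
  fixes x0 :: "real ^ 'd"
  assumes "0 < \<sigma>"
  shows "moment a \<sigma> x0 p k = ennreal (norm x0 powr p) * (ennreal (\<sigma> powr p) * prelu_moment a p TYPE('d)) ^ k"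
proof (induction k)
  case 0
  interpret prob_space "weight_space \<sigma> :: (nat \<times> 'd \<times> 'd \<Rightarrow> real) measure"
    by (rule prob_space_weight_space[OF assms])
  show ?case by (simp add: moment_def emeasure_space_1)
next
  case (Suc k)
  then show ?case unfolding moment_Suc[OF assms] by (simp add: mult_ac)
qed

section \<open>Growth and decay\<close>

text \<open>Positivity is read off the moment rather than the series: a nonpositive value would be
  truncated to 0 by \<open>ennreal\<close>, making \<open>prelu_sq\<close> vanish almost
  surely.\<close>

lemma I_a_pos:
  assumes "0 < a" "a \<le> 1" "0 < s" "s \<le> 2"
  shows "I_a a s CARD('d::finite) > 0"
proof (rule ccontr)
  assume "\<not> ?thesis"
  then have "prelu_moment a s TYPE('d) = 0"
    using prelu_moment_eq_I_a[OF assms, where 'd = 'd] by (simp add: ennreal_neg)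
  then have "AE z in (std_normal_vec :: ('d \<Rightarrow> real) measure). prelu_sq a z powr (s / 2) = 0"
    unfolding prelu_moment_def by (subst (asm) nn_integral_0_iff_AE) auto
  then show False using prelu_sq_not_AE_const[of a 0, where 'd = 'd] by simp
qed

text \<open>With \<open>x = exp t\<close>, dividing by \<open>exp t\<close> turns the claim into
  \<open>q < exp ((q - 1) * t) + (q - 1) * exp (- t)\<close>. Both exponentials are bounded below by
  their tangents at 0, the second one strictly, and the terms linear in \<open>t\<close>
  cancel.\<close>

lemma powr_gt_tangent_at_1:
  fixes x q :: real
  assumes "x \<ge> 0" "x \<noteq> 1" "q > 1"
  shows "1 + q * (x - 1) < x powr q"
proof (cases "x = 0")
  case False
  define t where "t = ln x"
  have x: "x = exp t" and "t \<noteq> 0" using assms False by (auto simp: t_def)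
  have "exp (- t) \<noteq> 1 - t"
    using ln_eq_minus_one[of "exp (- t)"] \<open>t \<noteq> 0\<close> by auto
  then have "1 - t < exp (- t)" using exp_ge_add_one_self[of "- t"] by simp
  then have "(q - 1) * (1 - t) < (q - 1) * exp (- t)" using assms by simp
  moreover have "1 + (q - 1) * t \<le> exp ((q - 1) * t)" by simp
  ultimately have "q < exp ((q - 1) * t) + (q - 1) * exp (- t)" by (simp add: algebra_simps)
  then have "q * exp t < (exp ((q - 1) * t) + (q - 1) * exp (- t)) * exp t" by simp
  also have "\<dots> = exp (q * t) + (q - 1)"
    by (simp add: algebra_simps flip: exp_add)
  finally show ?thesis by (simp add: x exp_powr_real algebra_simps)
qed (use assms in simp)

text \<open>The function \<open>f\<close> is the gap between \<open>U powr q\<close> and its tangent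
  at 1. Its integral could vanish only if \<open>U\<close> were almost surely 1, that is, if
  \<open>prelu_sq\<close> were almost surely constant.\<close>

lemma prelu_moment_strict_Jensen:
  fixes a \<sigma> s p :: real
  assumes "0 < \<sigma>" "0 < s" "s < p"
    and one: "ennreal (\<sigma> powr s) * prelu_moment a s TYPE('d::finite) = 1"
  shows "ennreal (\<sigma> powr p) * prelu_moment a p TYPE('d) > 1"
proof -
  let ?N = "std_normal_vec :: ('d \<Rightarrow> real) measure"
  define q where "q = p / s"
  have q: "q > 1" using assms by (simp add: q_def)
  define U where "U z = \<sigma> powr s * prelu_sq a z powr (s / 2)" for z :: "'d \<Rightarrow> real"
  define f where "f z = U z powr q - (1 + q * (U z - 1))" for z
  have [measurable]: "U \<in> borel_measurable ?N" unfolding U_def by measurable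
  have [measurable]: "f \<in> borel_measurable ?N" unfolding f_def by measurable
  have U: "0 \<le> U z" for z by (simp add: U_def)
  have f_pos: "f z > 0" if "U z \<noteq> 1" for z
    using powr_gt_tangent_at_1[OF U that q] by (simp add: f_def)
  have f: "0 \<le> f z" for z
    using f_pos[of z] by (cases "U z = 1") (auto simp: f_def)
  have "\<not> (AE z in ?N. f z = 0)"
  proof
    assume "AE z in ?N. f z = 0"
    \<comment> \<open>The constant is the solution \<open>S\<close> of
      \<open>\<sigma> powr s * S powr (s / 2) = 1\<close>.\<close>
    then have "AE z in ?N. prelu_sq a z = (1 / \<sigma> powr s) powr (2 / s)"
    proof eventually_elim
      case (elim z)
      then have "U z = 1" using f_pos[of z] by auto
      then have "1 / \<sigma> powr s = prelu_sq a z powr (s / 2)" using assms by (simp add: U_def field_simps)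
      then have "(1 / \<sigma> powr s) powr (2 / s) = (prelu_sq a z powr (s / 2)) powr (2 / s)" by simp
      also have "\<dots> = prelu_sq a z"
        using assms prelu_sq_nonneg[of a z] by (simp add: powr_powr)
      finally show ?case ..
    qed
    then show False using prelu_sq_not_AE_const[of a, where 'd = 'd] by blast
  qed
  then have int_f: "(\<integral>\<^sup>+z. ennreal (f z) \<partial>?N) \<noteq> 0"
    by (subst nn_integral_0_iff_AE) (use f in \<open>auto simp: ennreal_eq_0_iff order_antisym_conv\<close>)
  have int_U: "(\<integral>\<^sup>+z. ennreal (U z) \<partial>?N) = 1"
    using one unfolding U_def prelu_moment_def
    by (subst (asm) nn_integral_cmult[symmetric]) (auto simp: ennreal_mult')
  have "U z powr q = \<sigma> powr p * prelu_sq a z powr (p / 2)" for z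
    using assms by (simp add: U_def powr_mult powr_powr q_def)
  then have int_Uq: "(\<integral>\<^sup>+z. ennreal (U z powr q) \<partial>?N) = ennreal (\<sigma> powr p) * prelu_moment a p TYPE('d)"
    unfolding prelu_moment_def
    by (subst nn_integral_cmult[symmetric]) (auto simp: ennreal_mult')
  \<comment> \<open>The definition of \<open>f\<close> is rearranged so that all terms are
    nonnegative and no subtraction occurs in \<open>ennreal\<close>. The argument therefore also
    covers an infinite moment of order \<open>p\<close>; only the finite constant
    \<open>q - 1\<close> is cancelled.\<close>
  have "(\<integral>\<^sup>+z. ennreal (U z powr q) \<partial>?N) + ennreal (q - 1) =
      (\<integral>\<^sup>+z. ennreal (U z powr q) + ennreal (q - 1) \<partial>?N)"
    by (subst nn_integral_add) (simp_all add: std_normal_vec.emeasure_space_1)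
  also have "\<dots> = (\<integral>\<^sup>+z. ennreal (f z) + ennreal q * ennreal (U z) \<partial>?N)"
  proof (intro nn_integral_cong)
    fix z
    have "ennreal (U z powr q) + ennreal (q - 1) = ennreal (U z powr q + (q - 1))"
      using q by (intro ennreal_plus[symmetric]) auto
    also have "U z powr q + (q - 1) = f z + q * U z" by (simp add: f_def algebra_simps)
    also have "ennreal (f z + q * U z) = ennreal (f z) + ennreal (q * U z)"
      using q f[of z] U[of z] by (intro ennreal_plus) auto
    finally show "ennreal (U z powr q) + ennreal (q - 1) = ennreal (f z) + ennreal q * ennreal (U z)"
      using q U[of z] by (simp add: ennreal_mult')
  qed
  also have "\<dots> = (\<integral>\<^sup>+z. ennreal (f z) \<partial>?N) + ennreal q"
    by (simp add: nn_integral_add nn_integral_cmult int_U)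
  also have "ennreal q = 1 + ennreal (q - 1)"
    using q by (simp flip: ennreal_1 ennreal_plus)
  finally have "(\<integral>\<^sup>+z. ennreal (U z powr q) \<partial>?N) = (\<integral>\<^sup>+z. ennreal (f z) \<partial>?N) + 1"
    using ennreal_add_left_cancel[of "ennreal (q - 1)"] by (simp add: ac_simps)
  moreover have "1 < (\<integral>\<^sup>+z. ennreal (f z) \<partial>?N) + 1"
    using int_f by (cases "\<integral>\<^sup>+z. ennreal (f z) \<partial>?N") (auto simp: ennreal_less_iff simp flip: ennreal_1 ennreal_plus)
  ultimately show ?thesis unfolding int_Uq by simp
qed

theorem mainTheorem5:
  fixes x0 :: "real ^ 'd" and a s \<sigma> :: real
  assumes "0 < a" "a \<le> 1" "0 < s" "s \<le> 2" "0 < \<sigma>"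
  defines "d \<equiv> CARD('d)"
  shows "(\<forall>k. moment a \<sigma> x0 s k = ennreal (norm x0 powr s * (\<sigma> powr s * I_a a s d) ^ k))
    \<and> (x0 \<noteq> 0 \<longrightarrow>
        (\<sigma> = sigma_bar a s d \<longrightarrow>
           (\<forall>k\<ge>1. moment a \<sigma> x0 s k = ennreal (norm x0 powr s)) \<and>
           (\<forall>p>s. \<exists>C>0. \<exists>r>1. \<forall>k. moment a \<sigma> x0 p k \<ge> ennreal (C * r ^ k)))
      \<and> (\<sigma> < sigma_bar a s d \<longrightarrow>
           (\<exists>C>0. \<exists>r. 0 < r \<and> r < 1 \<and> (\<forall>k. moment a \<sigma> x0 s k \<le> ennreal (C * r ^ k))))
      \<and> (\<sigma> > sigma_bar a s d \<longrightarrow>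
           (\<exists>C>0. \<exists>r>1. \<forall>k. moment a \<sigma> x0 s k \<ge> ennreal (C * r ^ k))))"
proof -
  define I where "I = I_a a s d"
  \<comment> \<open>The growth factor per layer; by \<open>sb\<close> below it equals 1 exactly at
    the critical standard deviation, and it increases with \<sigma>.\<close>
  define r where "r = \<sigma> powr s * I"
  have I: "I > 0" unfolding I_def d_def by (rule I_a_pos[OF assms(1-4)])
  then have r: "r > 0" using assms by (simp add: r_def)
  have factor: "ennreal (\<sigma> powr s) * prelu_moment a s TYPE('d) = ennreal r"
    using prelu_moment_eq_I_a[OF assms(1-4), where 'd = 'd] by (simp add: r_def I_def d_def ennreal_mult')
  have mom: "moment a \<sigma> x0 s k = ennreal (norm x0 powr s * r ^ k)" for k
    unfolding moment_eq_power[OF assms(5)] factor using r by (simp add: ennreal_power ennreal_mult')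
  have sb: "sigma_bar a s d powr s * I = 1" "sigma_bar a s d > 0"
  proof -
    have eq: "sigma_bar a s d = I powr (- 1 / s)" by (simp only: sigma_bar_def I_def)
    show "sigma_bar a s d powr s * I = 1"
      unfolding eq powr_powr using I assms(3) by (simp add: powr_minus)
    show "sigma_bar a s d > 0" unfolding eq using I by simp
  qed
  have C: "norm x0 powr s > 0" if "x0 \<noteq> 0" for s using that by simp
  have crit: "\<exists>C>0. \<exists>\<rho>>1. \<forall>k. moment a \<sigma> x0 p k \<ge> ennreal (C * \<rho> ^ k)"
    if "x0 \<noteq> 0" "\<sigma> = sigma_bar a s d" "p > s" for p
  proof -
    have "r = 1" using sb that by (simp add: r_def)
    then have "1 < ennreal (\<sigma> powr p) * prelu_moment a p TYPE('d)"
      using factor assms that by (intro prelu_moment_strict_Jensen[of \<sigma> s p]) auto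
    \<comment> \<open>The factor of order \<open>p\<close> is not known to be finite, so a finite
      rate strictly between 1 and it is chosen by density of the order.\<close>
    then obtain e where e: "1 < e" "e < ennreal (\<sigma> powr p) * prelu_moment a p TYPE('d)"
      using dense by blast
    then have "e < top" by (meson order.strict_trans2 top_greatest)
    then obtain \<rho> where \<rho>: "\<rho> \<ge> 0" "e = ennreal \<rho>" by (auto simp: less_top_ennreal)
    have "\<rho> > 1" using e(1) \<rho> by (simp add: ennreal_less_iff flip: ennreal_1)
    moreover have "ennreal (norm x0 powr p * \<rho> ^ k) \<le> moment a \<sigma> x0 p k" for k
      unfolding moment_eq_power[OF assms(5)] using \<rho> e(2)
      by (subst ennreal_mult) (auto simp: ennreal_power[symmetric] intro!: mult_left_mono power_mono)
    ultimately show ?thesis using C[OF that(1), of p] by blast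
  qed
  have sub: "r < 1" if "\<sigma> < sigma_bar a s d"
  proof -
    have "\<sigma> powr s * I < sigma_bar a s d powr s * I"
      using that assms(3,5) I by (intro mult_strict_right_mono powr_less_mono2) auto
    then show ?thesis using sb(1) by (simp add: r_def)
  qed
  have super: "r > 1" if "\<sigma> > sigma_bar a s d"
  proof -
    have "sigma_bar a s d powr s * I < \<sigma> powr s * I"
      using that assms(3) sb(2) I by (intro mult_strict_right_mono powr_less_mono2) auto
    then show ?thesis using sb(1) by (simp add: r_def)
  qed
  show ?thesis
    unfolding I_def[symmetric] r_def[symmetric]
  proof (intro conjI impI allI)
    show "moment a \<sigma> x0 s k = ennreal (norm x0 powr s * r ^ k)" for k by (rule mom)
    show "moment a \<sigma> x0 s k = ennreal (norm x0 powr s)" if "\<sigma> = sigma_bar a s d" for k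
      using mom[of k] sb that by (simp add: r_def)
    show "\<exists>C>0. \<exists>r. 0 < r \<and> r < 1 \<and> (\<forall>k. moment a \<sigma> x0 s k \<le> ennreal (C * r ^ k))"
      if "x0 \<noteq> 0" "\<sigma> < sigma_bar a s d"
      using C[OF that(1)] sub[OF that(2)] r mom by (metis order_refl)
    show "\<exists>C>0. \<exists>r>1. \<forall>k. moment a \<sigma> x0 s k \<ge> ennreal (C * r ^ k)"
      if "x0 \<noteq> 0" "\<sigma> > sigma_bar a s d"
      using C[OF that(1)] super[OF that(2)] mom by (metis order_refl)
  qed (use crit in auto)
qed

end
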